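(* Let $\mathbb{K}$ be a field, let $m\ge 2$, $r\ge 2$, and let $n_1,\dots,n_r$ be positive integers with $n_r\ge 2$ and $1=n_1=n_2=\cdots=n_{s-1}<n_s\le\cdots\le n_r$ for some $s\in\{1,\dots,r\}$. Put $n=\sum_{j=1}^r n_j$, let $G=K_{n_1,\dots,n_r}$ be the complete $r$-partite graph on $[n]$ with parts $V_1,\dots,V_r$, $|V_k|=n_k$, and let $\widetilde{G}$ be the complete graph on $[n]$. Let $S=\mathbb{K}[x_{ij}: i\in[m],\, j\in[n]]$. For each $k\in\{s,s+1,\dots,r\}$ let $T_k=\bigsqcup_{j\ne k}V_j$ and let $A_k=(x_{ij}: i\in[m],\, j\in T_k)\subset S$. Then the minimal primary decomposition of $\mathcal{J}_{K_m,G}$ is \[ \mathcal{J}_{K_m,G}=\mathcal{J}_{K_m,\widetilde{G}}\cap A_s\cap A_{s+1}\cap\cdots\cap A_r, \] and the Krull dimension of the quotient is \[ \dim(S/\mathcal{J}_{K_m,G})=\max\{m+n-1,\; mn_r\}. \]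
   Context: For a positive integer $a$, $[a]=\{1,\dots,a\}$. For a finite simple graph $H$ on the vertex set $[n]$, the generalized binomial edge ideal of $H$ is the ideal $\mathcal{J}_{K_m,H}$ of $S=\mathbb{K}[x_{ij}: i\in[m], j\in[n]]$ generated by all $2$-minors $x_{ik}x_{jl}-x_{il}x_{jk}$ with $1\le i<j\le m$ and $\{k,l\}\in E(H)$, $k<l$. The complete $r$-partite graph $K_{n_1,\dots,n_r}$ has vertex set $[n]=V_1\sqcup\cdots\sqcup V_r$, where $V_k=\{1+\sum_{j=1}^{k-1}n_j,\dots,\sum_{j=1}^{k}n_j\}$, and two vertices are adjacent if and only if they lie in different parts $V_i$, $V_j$ ($i\neq j$). The index $s$ is the smallest index with $n_s\ge 2$. *)

theory Defs
  imports "HOL-Algebra.QuotRing" "HOL-Library.Poly_Mapping" "HOL-Library.Extended_Nat"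
    "HOL-Library.Multiset"
begin

section \<open>Polynomial rings\<close>

text \<open>A monomial is a finitely supported exponent vector; a polynomial is a finitely supported
  function from monomials to coefficients. Multiplication in \<^theory>\<open>HOL-Library.Poly_Mapping\<close>
  is convolution, that is, the usual product of polynomials.\<close>

type_synonym ('v, 'k) mpoly = "('v \<Rightarrow>\<^sub>0 nat) \<Rightarrow>\<^sub>0 'k"

definition mpoly_var :: "'v \<Rightarrow> ('v, 'k::comm_ring_1) mpoly" where
  "mpoly_var v = Poly_Mapping.single (Poly_Mapping.single v 1) 1"

text \<open>The ring \<open>\<K>[x\<^sub>v : v \<in> V]\<close>: the polynomials involving only variables from \<open>V\<close>.\<close>

definition mpoly_ring :: "'v set \<Rightarrow> ('v, 'k::comm_ring_1) mpoly ring" where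
  "mpoly_ring V =
     \<lparr>carrier = {p. \<forall>t \<in> Poly_Mapping.keys p. Poly_Mapping.keys t \<subseteq> V},
      monoid.mult = (*), one = 1, zero = 0, add = (+)\<rparr>"

lemma mpoly_ring_simps:
  "p \<in> carrier (mpoly_ring V) \<longleftrightarrow> (\<forall>t \<in> Poly_Mapping.keys p. Poly_Mapping.keys t \<subseteq> V)"
  "monoid.mult (mpoly_ring V) = (*)"
  "\<one>\<^bsub>mpoly_ring V\<^esub> = 1"
  "\<zero>\<^bsub>mpoly_ring V\<^esub> = 0"
  "add (mpoly_ring V) = (+)"
  by (simp_all add: mpoly_ring_def)

lemma mpoly_var_in_carrier: "v \<in> V \<Longrightarrow> mpoly_var v \<in> carrier (mpoly_ring V)"
  by (simp add: mpoly_var_def mpoly_ring_simps)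

lemma cring_mpoly_ring: "cring (mpoly_ring V :: ('v, 'k::comm_ring_1) mpoly ring)"
proof (rule cringI)
  have add: "p + q \<in> carrier (mpoly_ring V)"
    if "p \<in> carrier (mpoly_ring V)" "q \<in> carrier (mpoly_ring V)"
    for p q :: "('v, 'k) mpoly"
    using that Poly_Mapping.keys_add[of p q] by (auto simp: mpoly_ring_simps)
  have uminus: "- p \<in> carrier (mpoly_ring V)" if "p \<in> carrier (mpoly_ring V)"
    for p :: "('v, 'k) mpoly"
    using that by (simp add: mpoly_ring_simps)
  have mult: "p * q \<in> carrier (mpoly_ring V)"
    if p: "p \<in> carrier (mpoly_ring V)" and q: "q \<in> carrier (mpoly_ring V)"
    for p q :: "('v, 'k) mpoly"
    unfolding mpoly_ring_simps
  proof
    fix t assume "t \<in> Poly_Mapping.keys (p * q)"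
    then obtain a b where t: "t = a + b" "a \<in> Poly_Mapping.keys p" "b \<in> Poly_Mapping.keys q"
      using keys_mult[of p q] by auto
    then have "Poly_Mapping.keys a \<subseteq> V" "Poly_Mapping.keys b \<subseteq> V"
      using p q by (auto simp: mpoly_ring_simps)
    then show "Poly_Mapping.keys t \<subseteq> V"
      using t Poly_Mapping.keys_add[of a b] by blast
  qed
  have zero: "(0 :: ('v, 'k) mpoly) \<in> carrier (mpoly_ring V)"
    by (simp add: mpoly_ring_simps)
  show "abelian_group (mpoly_ring V :: ('v, 'k) mpoly ring)"
  proof (rule abelian_groupI)
    fix x :: "('v, 'k) mpoly" assume x: "x \<in> carrier (mpoly_ring V)"
    show "\<exists>y \<in> carrier (mpoly_ring V). y \<oplus>\<^bsub>mpoly_ring V\<^esub> x = \<zero>\<^bsub>mpoly_ring V\<^esub>"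
      by (rule bexI[OF _ uminus[OF x]]) (simp add: mpoly_ring_simps(2-))
  qed (use add zero in \<open>simp_all add: mpoly_ring_simps(2-) add.assoc add.commute\<close>)
  show "comm_monoid (mpoly_ring V :: ('v, 'k) mpoly ring)"
    by (rule comm_monoidI)
      (use mult in \<open>auto simp: mpoly_ring_simps(2-) mult.assoc mult.commute\<close>,
       simp add: mpoly_ring_simps(1))
qed (simp add: mpoly_ring_simps(2-) distrib_right)


section \<open>Primary decompositions and Krull dimension\<close>

definition radical_ideal :: "('a, 'b) ring_scheme \<Rightarrow> 'a set \<Rightarrow> 'a set" where
  "radical_ideal R I = {a \<in> carrier R. \<exists>k::nat. k > 0 \<and> a [^]\<^bsub>R\<^esub> k \<in> I}"

definition primary_ideal :: "'a set \<Rightarrow> ('a, 'b) ring_scheme \<Rightarrow> bool" where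
  "primary_ideal Q R \<longleftrightarrow> ideal Q R \<and> cring R \<and> Q \<noteq> carrier R \<and>
     (\<forall>a \<in> carrier R. \<forall>b \<in> carrier R. a \<otimes>\<^bsub>R\<^esub> b \<in> Q \<longrightarrow> a \<in> Q \<or> b \<in> radical_ideal R Q)"

text \<open>The components form a list, so that components occurring twice are excluded
  by the distinctness of the radicals. The intersection with \<^term>\<open>carrier R\<close> matters
  only for an empty family of components, whose intersection is the whole ring.\<close>

definition minimal_primary_decomposition ::
  "('a, 'b) ring_scheme \<Rightarrow> 'a set \<Rightarrow> 'a set list \<Rightarrow> bool" where
  "minimal_primary_decomposition R I Qs \<longleftrightarrow>
     (\<forall>Q \<in> set Qs. primary_ideal Q R) \<and>
     I = carrier R \<inter> \<Inter> (set Qs) \<and>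
     distinct (map (radical_ideal R) Qs) \<and>
     (\<forall>i < length Qs. \<not> carrier R \<inter> (\<Inter>j \<in> {..<length Qs} - {i}. Qs ! j) \<subseteq> Qs ! i)"

text \<open>The supremum of the lengths \<open>l\<close> of chains \<open>P\<^sub>0 \<subset> \<dots> \<subset> P\<^sub>l\<close> of prime ideals.
  The zero ring gets dimension \<open>0\<close> here.\<close>

definition krull_dim :: "('a, 'b) ring_scheme \<Rightarrow> enat" where
  "krull_dim R = Sup {enat l | l. \<exists>P :: nat \<Rightarrow> 'a set.
     (\<forall>i \<le> l. primeideal (P i) R) \<and> (\<forall>i < l. P i \<subset> P (Suc i))}"


section \<open>Graphs and generalized binomial edge ideals\<close>

text \<open>A simple graph on \<open>{1..n}\<close> is given by its set of edges, each edge being a two-element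
  subset of \<open>{1..n}\<close>.\<close>

definition complete_edges :: "nat \<Rightarrow> nat set set" where
  "complete_edges n = {{u, v} | u v. u \<in> {1..n} \<and> v \<in> {1..n} \<and> u \<noteq> v}"

definition part :: "(nat \<Rightarrow> nat) \<Rightarrow> nat \<Rightarrow> nat set" where
  "part ns k = {1 + (\<Sum>j \<in> {1..<k}. ns j)..(\<Sum>j \<in> {1..k}. ns j)}"

definition multipartite_edges :: "nat \<Rightarrow> (nat \<Rightarrow> nat) \<Rightarrow> nat set set" where
  "multipartite_edges r ns =
     {{u, v} | u v i j. i \<in> {1..r} \<and> j \<in> {1..r} \<and> i \<noteq> j \<and> u \<in> part ns i \<and> v \<in> part ns j}"

text \<open>The variable \<open>x\<^sub>i\<^sub>j\<close> of \<open>S = \<K>[x\<^sub>i\<^sub>j : i \<in> {1..m}, j \<in> {1..n}]\<close> is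
  \<^term>\<open>mpoly_var (i, j)\<close>.\<close>

abbreviation matrix_ring :: "nat \<Rightarrow> nat \<Rightarrow> (nat \<times> nat, 'k::field) mpoly ring" where
  "matrix_ring m n \<equiv> mpoly_ring ({1..m} \<times> {1..n})"

definition gen_binomial_edge_ideal ::
  "nat \<Rightarrow> nat \<Rightarrow> nat set set \<Rightarrow> (nat \<times> nat, 'k::field) mpoly set" where
  "gen_binomial_edge_ideal m n E = genideal (matrix_ring m n)
     {mpoly_var (i, k) * mpoly_var (j, l) - mpoly_var (i, l) * mpoly_var (j, k) | i j k l.
        1 \<le> i \<and> i < j \<and> j \<le> m \<and> k \<in> {1..n} \<and> l \<in> {1..n} \<and> k < l \<and> {k, l} \<in> E}"

definition column_ideal ::
  "nat \<Rightarrow> nat \<Rightarrow> nat set \<Rightarrow> (nat \<times> nat, 'k::field) mpoly set" where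
  "column_ideal m n T = genideal (matrix_ring m n) {mpoly_var (i, j) | i j. i \<in> {1..m} \<and> j \<in> T}"

end

(*
  Two monomials x^M, x^M' with the same row and column sums are congruent modulo J as soon
  as the columns of M meet two different parts: two entries in different parts can exchange their
  rows by a generator, and two entries in the same part can do so with the help of a third entry
  in another part. For singleton parts this identifies the ideal Jc of the complete graph with the
  kernel of the Segre map x_ij -> s_i t_j, which is prime. A polynomial in Jc and all the A_k has
  only monomials whose columns meet two parts or lie in a singleton part (where the row and column
  sums determine the monomial), so it is a combination of binomials that lie in J. As Jc and the A_k
  are pairwise incomparable primes, the decomposition is minimal and unique.

  For the dimension, a chain of primes of length l yields l elements that are algebraically
  independent modulo its bottom, which contains Jc or some A_k. Hence l is at most the number of
  variables of a polynomial ring containing the quotient: m + n - 1 for Jc (dehomogenize by s_1 = 1)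
  and m n_k for A_k. Setting these variables to zero one after the other gives chains of this length.
*)
theory Submission
  imports Defs "HOL-Library.Product_Lexorder"
begin

section \<open>Intersections of prime ideals\<close>

text \<open>The obstacle is a monomial whose columns all lie in one part: no generator of
  \<open>J\<close> touches it, so it cannot be rearranged modulo \<open>J\<close>. The ideals
  \<open>A k\<close> exclude exactly these monomials when the part has at least two vertices. A
  function \<open>c\<close> from columns to classes treats both graphs at once:
  \<open>c = id\<close> for the complete graph, the index of the part for \<open>G\<close>. Every
  explicit prime has the shape \<open>subst_ideal V \<sigma> W\<close>: substitute polynomials for
  the variables, then erase the variables in \<open>W\<close>. Primality is inherited from the
  target polynomial ring, and enlarging \<open>W\<close> one variable at a time gives the long
  chains. Chains in the upper bound consist of arbitrary primes, so one element is extracted from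
  each strict inclusion, and the number of independent elements is bounded by comparing how fast
  spaces of polynomials grow with the degree. Uniqueness concerns the components themselves and not
  just their radicals; it holds because no prime of the family contains another, so there are no
  embedded components.\<close>

lemma (in cring) finite_Inter_subset_primeideal:
  assumes "finite F" "\<And>I. I \<in> F \<Longrightarrow> ideal I R" "primeideal P R" "carrier R \<inter> \<Inter> F \<subseteq> P"
  shows "\<exists>I \<in> F. I \<subseteq> P"
  using assms
proof (induction F rule: finite_induct)
  case empty
  then interpret P: primeideal P R by simp
  show ?case using empty P.I_notcarr P.a_subset by auto
next
  case (insert I F)
  interpret P: primeideal P R by fact
  show ?case
  proof (cases "I \<subseteq> P")
    case False
    then obtain a where a: "a \<in> I" "a \<notin> P" by auto
    have I: "ideal I R" using insert.prems by auto
    have ac: "a \<in> carrier R" using ideal.Icarr[OF I a(1)] .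
    \<comment> \<open>Multiplying by the fixed \<open>a\<close> in \<open>I\<close> moves an element
      of the remaining intersection into the full one, hence into \<open>P\<close>; since
      \<open>a\<close> is outside \<open>P\<close>, primality removes it again.\<close>
    have "carrier R \<inter> \<Inter> F \<subseteq> P"
    proof
      fix b assume b: "b \<in> carrier R \<inter> \<Inter> F"
      have "a \<otimes> b \<in> I" using ideal.I_r_closed[OF I a(1)] b by auto
      moreover have "a \<otimes> b \<in> K" if "K \<in> F" for K
        using ideal.I_l_closed[of K R b a] insert.prems that b ac by auto
      ultimately have "a \<otimes> b \<in> P" using insert.prems ac b by auto
      then show "b \<in> P" using P.I_prime[OF ac] a b by auto
    qed
    then show ?thesis using insert by auto
  qed auto
qed

lemma (in cring) primeideal_pow_mem:
  assumes "primeideal P R" "a \<in> carrier R" "a [^] (k::nat) \<in> P" "k > 0"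
  shows "a \<in> P"
  using assms(3,4)
proof (induction k)
  case (Suc k)
  interpret P: primeideal P R by fact
  show ?case
  proof (cases "k = 0")
    case True then show ?thesis using Suc assms(2) by simp
  next
    case False
    then show ?thesis using P.I_prime[of "a [^] k" a] Suc assms(2) by auto
  qed
qed simp

lemma (in cring) radical_primeideal:
  assumes "primeideal P R"
  shows "radical_ideal R P = P"
proof -
  interpret P: primeideal P R by fact
  have "a \<in> radical_ideal R P" if "a \<in> P" for a
    unfolding radical_ideal_def using that P.Icarr by (auto intro!: exI[of _ "1::nat"])
  moreover have "a \<in> P" if "a \<in> radical_ideal R P" for a
    using that primeideal_pow_mem[OF assms, of a] unfolding radical_ideal_def by blast
  ultimately show ?thesis by blast
qed

lemma (in cring) primeideal_imp_primary_ideal: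
  assumes "primeideal P R"
  shows "primary_ideal P R"
proof -
  interpret P: primeideal P R by fact
  show ?thesis unfolding primary_ideal_def radical_primeideal[OF assms]
    using P.I_notcarr P.I_prime P.is_ideal is_cring by auto
qed

text \<open>Irredundancy comes from primality: a component containing the intersection of the others
  would contain one of them, against incomparability.\<close>

lemma (in cring) minimal_primary_decomposition_primes:
  assumes prime: "\<And>P. P \<in> set Ps \<Longrightarrow> primeideal P R"
    and incomp: "\<And>P Q. P \<in> set Ps \<Longrightarrow> Q \<in> set Ps \<Longrightarrow> P \<subseteq> Q \<Longrightarrow> P = Q"
    and "distinct Ps" and I: "I = carrier R \<inter> \<Inter> (set Ps)"
  shows "minimal_primary_decomposition R I Ps"
  unfolding minimal_primary_decomposition_def
proof (intro conjI ballI allI impI notI)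
  show "primary_ideal P R" if "P \<in> set Ps" for P
    using prime[OF that] by (rule primeideal_imp_primary_ideal)
  show "I = carrier R \<inter> \<Inter> (set Ps)" by fact
  have "map (radical_ideal R) Ps = map id Ps"
    using prime radical_primeideal by (intro map_cong) auto
  then show "distinct (map (radical_ideal R) Ps)" using \<open>distinct Ps\<close> by simp
next
  fix i assume i: "i < length Ps"
    and "carrier R \<inter> (\<Inter>j\<in>{..<length Ps} - {i}. Ps ! j) \<subseteq> Ps ! i"
  then have "\<exists>K \<in> (!) Ps ` ({..<length Ps} - {i}). K \<subseteq> Ps ! i"
    using prime by (intro finite_Inter_subset_primeideal) (auto simp: primeideal.axioms(1))
  then obtain j where "j < length Ps" "j \<noteq> i" "Ps ! j \<subseteq> Ps ! i" by auto
  then show False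
    using incomp[of "Ps ! j" "Ps ! i"] i \<open>distinct Ps\<close> by (auto simp: nth_eq_iff_index_eq)
qed

text \<open>Every prime \<open>P\<close> of the family contains some \<open>Q\<close> of the given decomposition, and the radical
  of \<open>Q\<close> contains some prime of the family, which must be \<open>P\<close>; irredundancy then rules out further
  components. If \<open>b\<close> lies in all primes of the family except \<open>P\<close>, then \<open>b a \<in> Q\<close> for
  all \<open>a \<in> P\<close>, whence \<open>a \<in> Q\<close> as \<open>Q\<close> is primary.\<close>

lemma (in cring) minimal_primary_decomposition_primes_unique:
  assumes prime: "\<And>P. P \<in> set Ps \<Longrightarrow> primeideal P R"
    and incomp: "\<And>P Q. P \<in> set Ps \<Longrightarrow> Q \<in> set Ps \<Longrightarrow> P \<subseteq> Q \<Longrightarrow> P = Q"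
    and "distinct Ps" and I: "I = carrier R \<inter> \<Inter> (set Ps)"
    and Qs: "minimal_primary_decomposition R I Qs"
  shows "mset Qs = mset Ps"
proof -
  have prim: "primary_ideal Q R" if "Q \<in> set Qs" for Q
    using Qs that by (auto simp: minimal_primary_decomposition_def)
  have idl: "ideal Q R" if "Q \<in> set Qs" for Q
    using prim[OF that] by (auto simp: primary_ideal_def)
  have IQ: "I = carrier R \<inter> \<Inter> (set Qs)" and dist: "distinct (map (radical_ideal R) Qs)"
    and irred: "\<And>i. i < length Qs \<Longrightarrow>
      \<not> carrier R \<inter> (\<Inter>j\<in>{..<length Qs} - {i}. Qs ! j) \<subseteq> Qs ! i"
    using Qs by (auto simp: minimal_primary_decomposition_def)
  have radP: "radical_ideal R Q \<subseteq> P" if "primeideal P R" "Q \<subseteq> P" for P Q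
    using primeideal_pow_mem[OF that(1)] that(2) unfolding radical_ideal_def by blast
  have Qrad: "Q \<subseteq> radical_ideal R Q" if "Q \<in> set Qs" for Q
    unfolding radical_ideal_def using ideal.Icarr[OF idl[OF that]]
    by (auto intro!: exI[of _ "1::nat"])
  have step: "\<exists>Q \<in> set Qs. Q \<subseteq> P \<and> radical_ideal R Q = P" if P: "P \<in> set Ps" for P
  proof -
    have "carrier R \<inter> \<Inter> (set Qs) \<subseteq> P" using IQ I P by auto
    then obtain Q where Q: "Q \<in> set Qs" "Q \<subseteq> P"
      using finite_Inter_subset_primeideal[of "set Qs" P] idl prime[OF P] by auto
    have "\<exists>P' \<in> set Ps. P' \<subseteq> radical_ideal R Q"
    proof (rule ccontr)
      assume "\<not> ?thesis"
      then have "\<forall>P' \<in> set Ps. \<exists>a. a \<in> P' \<and> a \<notin> radical_ideal R Q" by auto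
      then obtain a where a: "\<And>P'. P' \<in> set Ps \<Longrightarrow> a P' \<in> P' \<and> a P' \<notin> radical_ideal R Q"
        by metis
      have ac: "a P' \<in> carrier R" if "P' \<in> set Ps" for P'
        using a[OF that] ideal.Icarr[OF primeideal.axioms(1)[OF prime[OF that]]] by auto
      \<comment> \<open>Multiply the chosen elements \<open>a P'\<close> one at a time. The product
        lies in every prime of the family, hence in \<open>I\<close> and in \<open>Q\<close>, yet it
        stays outside the radical of \<open>Q\<close>.\<close>
      have key: "\<exists>b \<in> carrier R. b \<notin> radical_ideal R Q \<and> (\<forall>P' \<in> set Ls. b \<in> P')"
        if "set Ls \<subseteq> set Ps" for Ls
        using that
      proof (induction Ls)
        case Nil
        have "\<one> \<notin> radical_ideal R Q"
          using prim[OF Q(1)] ideal.one_imp_carrier[of Q R]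
          by (auto simp: primary_ideal_def radical_ideal_def)
        then show ?case by auto
      next
        case (Cons P' Ls)
        then obtain b where b: "b \<in> carrier R" "b \<notin> radical_ideal R Q" "\<forall>P' \<in> set Ls. b \<in> P'"
          by auto
        have P': "P' \<in> set Ps" using Cons by auto
        have idP: "ideal L R" if "L \<in> set Ps" for L using prime[OF that] by (rule primeideal.axioms)
        \<comment> \<open>The radical of a primary ideal is prime; the argument is carried out here
          for these two factors.\<close>
        have "b \<otimes> a P' \<notin> radical_ideal R Q"
        proof
          assume "b \<otimes> a P' \<in> radical_ideal R Q"
          then obtain k :: nat where k: "k > 0" "(b \<otimes> a P') [^] k \<in> Q"
            by (auto simp: radical_ideal_def)
          then have "b [^] k \<otimes> a P' [^] k \<in> Q"
            using b(1) ac[OF P'] by (simp add: nat_pow_distrib)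
          then have "b [^] k \<in> Q \<or> a P' [^] k \<in> radical_ideal R Q"
            using prim[OF Q(1)] nat_pow_closed[OF b(1)] nat_pow_closed[OF ac[OF P']]
            unfolding primary_ideal_def by blast
          then show False
          proof
            assume "b [^] k \<in> Q"
            then have "b \<in> radical_ideal R Q" unfolding radical_ideal_def using b(1) k(1) by blast
            then show False using b(2) by simp
          next
            assume "a P' [^] k \<in> radical_ideal R Q"
            then obtain l :: nat where "l > 0" "(a P' [^] k) [^] l \<in> Q"
              by (auto simp: radical_ideal_def)
            then have "k * l > 0" "a P' [^] (k * l) \<in> Q" using ac[OF P'] k(1) by (auto simp: nat_pow_pow)
            then have "a P' \<in> radical_ideal R Q" unfolding radical_ideal_def using ac[OF P'] by blast
            then show False using a[OF P'] by simp
          qed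
        qed
        moreover have "b \<otimes> a P' \<in> P'"
          using ideal.I_l_closed[OF idP[OF P']] a[OF P'] b by auto
        moreover have "b \<otimes> a P' \<in> L" if "L \<in> set Ls" for L
          using ideal.I_r_closed[OF idP] that Cons.prems b ac[OF P'] by auto
        ultimately show ?case using b ac[OF P'] by (auto intro!: bexI[of _ "b \<otimes> a P'"])
      qed
      then obtain b where "b \<in> carrier R" "b \<notin> radical_ideal R Q" "\<forall>P' \<in> set Ps. b \<in> P'"
        using key[of Ps] by auto
      then have "b \<in> I" using I by auto
      then have "b \<in> Q" using IQ Q(1) by auto
      then show False using Qrad[OF Q(1)] \<open>b \<notin> radical_ideal R Q\<close> by auto
    qed
    then obtain P' where P': "P' \<in> set Ps" "P' \<subseteq> radical_ideal R Q" by auto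
    then have "P' = P" using incomp[OF P'(1) P] radP[OF prime[OF P] Q(2)] by auto
    then show ?thesis using P' Q radP[OF prime[OF P] Q(2)] by auto
  qed
  have sub: "\<exists>P \<in> set Ps. radical_ideal R Q = P" if Q: "Q \<in> set Qs" for Q
  proof (rule ccontr)
    assume no: "\<not> ?thesis"
    obtain i where i: "i < length Qs" "Qs ! i = Q" using Q by (auto simp: in_set_conv_nth)
    \<comment> \<open>Each \<open>P\<close> contains a component with radical \<open>P\<close>,
      which is not \<open>Q\<close> by assumption. So the other components alone already cut down to
      \<open>I\<close>, making \<open>Q\<close> redundant.\<close>
    have "carrier R \<inter> (\<Inter>j\<in>{..<length Qs} - {i}. Qs ! j) \<subseteq> Q"
    proof
      fix x assume x: "x \<in> carrier R \<inter> (\<Inter>j\<in>{..<length Qs} - {i}. Qs ! j)"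
      have "x \<in> P" if P: "P \<in> set Ps" for P
      proof -
        obtain Q' where Q': "Q' \<in> set Qs" "Q' \<subseteq> P" "radical_ideal R Q' = P"
          using step[OF P] by auto
        then obtain j where "j < length Qs" "Qs ! j = Q'" by (auto simp: in_set_conv_nth)
        moreover have "Q' \<noteq> Q" using no Q' P by auto
        ultimately show ?thesis using x Q' i by auto
      qed
      then show "x \<in> Q" using x I IQ Q by auto
    qed
    then show False using irred[OF i(1)] i by simp
  qed
  have inj: "inj_on (radical_ideal R) (set Qs)" using dist by (simp add: distinct_map)
  have eq: "Q = P" if Q: "Q \<in> set Qs" and P: "P \<in> set Ps" and QP: "radical_ideal R Q = P" for P Q
  proof
    show "Q \<subseteq> P" using Qrad[OF Q] QP by simp
    show "P \<subseteq> Q"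
    proof
      fix a assume a: "a \<in> P"
      have ac: "a \<in> carrier R" using a ideal.Icarr[OF primeideal.axioms(1)[OF prime[OF P]]] by auto
      have "\<not> carrier R \<inter> \<Inter> (set Ps - {P}) \<subseteq> P"
        using finite_Inter_subset_primeideal[of "set Ps - {P}" P] prime incomp P
        by (auto simp: primeideal.axioms(1))
      then obtain b where b: "b \<in> carrier R" "b \<notin> P" "\<And>L. L \<in> set Ps \<Longrightarrow> L \<noteq> P \<Longrightarrow> b \<in> L"
        by auto
      have "a \<otimes> b \<in> L" if "L \<in> set Ps" for L
        using ideal.I_r_closed[of P R a b] ideal.I_l_closed[of L R b a] prime[OF P] prime[OF that]
          a b ac that by (cases "L = P") (auto simp: primeideal.axioms(1))
      then have "a \<otimes> b \<in> Q" using I IQ Q ac b by auto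
      then show "a \<in> Q" using prim[OF Q] ac b QP by (auto simp: primary_ideal_def)
    qed
  qed
  have "set Qs = set Ps"
  proof (intro equalityI subsetI)
    show "Q \<in> set Ps" if "Q \<in> set Qs" for Q
      using sub[OF that] eq[OF that] by metis
    show "P \<in> set Qs" if P: "P \<in> set Ps" for P
    proof -
      obtain Q where "Q \<in> set Qs" "radical_ideal R Q = P" using step[OF P] by auto
      then show ?thesis using eq[OF _ P] by metis
    qed
  qed
  moreover have "distinct Qs" using dist by (simp add: distinct_map)
  ultimately show ?thesis using \<open>distinct Ps\<close> by (simp add: set_eq_iff_mset_eq_distinct)
qed

section \<open>Krull dimension of quotients\<close>

text \<open>An ideal of the quotient is a set of cosets, so its union is its preimage under the
  projection.\<close>

lemma (in cring) primeideal_Union_quot: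
  assumes I: "ideal I R" and P: "primeideal P (R Quot I)"
  shows "primeideal (\<Union> P) R" "I \<subseteq> \<Union> P"
proof -
  interpret I: ideal I R by fact
  interpret h: ring_hom_ring R "R Quot I" "(+>) I" by (rule I.rcos_ring_hom_ring)
  interpret P: primeideal P "R Quot I" by fact
  have "\<Union> P = {r \<in> carrier R. I +> r \<in> P}"
    using canonical_proj_vimage_mem_iff[OF I P.a_subset]
      canonical_proj_vimage_in_carrier[OF I P.a_subset] by auto
  then show "primeideal (\<Union> P) R" using h.primeideal_vimage[OF is_cring P] by simp
  have "I \<in> P" using P.zero_closed by (simp only: FactRing_def ring.simps)
  then show "I \<subseteq> \<Union> P" by auto
qed

lemma (in cring) Union_psubset_quot:
  assumes I: "ideal I R" and P: "primeideal P (R Quot I)" "primeideal Q (R Quot I)" "P \<subset> Q"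
  shows "\<Union> P \<subset> \<Union> Q"
proof -
  interpret I: ideal I R by fact
  interpret P: primeideal P "R Quot I" by fact
  interpret Q: primeideal Q "R Quot I" by fact
  obtain X where X: "X \<in> Q" "X \<notin> P" using P(3) by auto
  then obtain a where a: "a \<in> carrier R" "X = I +> a"
    using Q.a_subset by (auto simp: FactRing_def A_RCOSETS_def')
  then have "a \<in> \<Union> Q" "a \<notin> \<Union> P"
    using X canonical_proj_vimage_mem_iff[OF I Q.a_subset a(1)]
      canonical_proj_vimage_mem_iff[OF I P.a_subset a(1)] by auto
  then show ?thesis using P(3) by auto
qed

text \<open>As \<open>I \<subseteq> P\<close>, the prime \<open>P\<close> is a union of cosets of
  \<open>I\<close>, so membership of a coset in the image can be tested on any representative. The
  second claim recovers \<open>P\<close> from its image and thus keeps strict inclusions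
  strict.\<close>

lemma (in cring) primeideal_image_quot:
  assumes I: "ideal I R" and P: "primeideal P R" "I \<subseteq> P"
  shows "primeideal ((+>) I ` P) (R Quot I)"
    and "{r \<in> carrier R. I +> r \<in> (+>) I ` P} = P"
proof -
  interpret I: ideal I R by fact
  interpret P: primeideal P R by fact
  interpret h: ring_hom_ring R "R Quot I" "(+>) I" by (rule I.rcos_ring_hom_ring)
  have id: "ideal ((+>) I ` P) (R Quot I)"
    using ring_ideal_imp_quot_ideal[OF I P.is_ideal] .
  have mem: "r \<in> P" if "r \<in> carrier R" "I +> r \<in> (+>) I ` P" for r
  proof -
    obtain p where p: "p \<in> P" "I +> r = I +> p" using \<open>I +> r \<in> (+>) I ` P\<close> by auto
    then have "r \<in> I +> p" using I.a_rcos_self[OF that(1)] by simp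
    then obtain i where "i \<in> I" "r = i \<oplus> p" by (auto simp: a_r_coset_def')
    then show ?thesis using p P(2) P.a_closed by auto
  qed
  then show eq: "{r \<in> carrier R. I +> r \<in> (+>) I ` P} = P" using P.Icarr by auto
  interpret Q: cring "R Quot I" using I.quotient_is_cring[OF is_cring] .
  show "primeideal ((+>) I ` P) (R Quot I)"
  proof (rule primeidealI[OF id Q.is_cring])
    show "carrier (R Quot I) \<noteq> (+>) I ` P"
    proof
      assume "carrier (R Quot I) = (+>) I ` P"
      then have "carrier R \<subseteq> P" using mem h.hom_closed by blast
      then show False using P.I_notcarr P.a_subset by blast
    qed
    fix X Y assume X: "X \<in> carrier (R Quot I)" and Y: "Y \<in> carrier (R Quot I)"
      and XY: "X \<otimes>\<^bsub>R Quot I\<^esub> Y \<in> (+>) I ` P"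
    have C: "carrier (R Quot I) = (+>) I ` carrier R"
      unfolding FactRing_def A_RCOSETS_def' partial_object.simps by blast
    obtain a b where ab: "a \<in> carrier R" "X = I +> a" "b \<in> carrier R" "Y = I +> b"
      using X Y unfolding C by blast
    then have "I +> (a \<otimes> b) \<in> (+>) I ` P" using XY h.hom_mult[of a b] by metis
    then have "a \<otimes> b \<in> P" using mem m_closed ab by blast
    then have "a \<in> P \<or> b \<in> P" using P.I_prime ab by blast
    then show "X \<in> (+>) I ` P \<or> Y \<in> (+>) I ` P" using ab by blast
  qed
qed

lemma (in cring) krull_dim_quot:
  assumes I: "ideal I R"
  shows "krull_dim (R Quot I) = Sup {enat l | l. \<exists>P :: nat \<Rightarrow> 'a set.
    (\<forall>i \<le> l. primeideal (P i) R \<and> I \<subseteq> P i) \<and> (\<forall>i < l. P i \<subset> P (Suc i))}"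
proof -
  have "(\<exists>P :: nat \<Rightarrow> 'a set set.
      (\<forall>i \<le> l. primeideal (P i) (R Quot I)) \<and> (\<forall>i < l. P i \<subset> P (Suc i))) \<longleftrightarrow>
    (\<exists>P :: nat \<Rightarrow> 'a set.
      (\<forall>i \<le> l. primeideal (P i) R \<and> I \<subseteq> P i) \<and> (\<forall>i < l. P i \<subset> P (Suc i)))"
    (is "?L \<longleftrightarrow> ?R") for l :: nat
  proof
    assume ?L
    then obtain P :: "nat \<Rightarrow> 'a set set" where P:
      "\<And>i. i \<le> l \<Longrightarrow> primeideal (P i) (R Quot I)" "\<And>i. i < l \<Longrightarrow> P i \<subset> P (Suc i)" by blast
    have "\<forall>i \<le> l. primeideal (\<Union> (P i)) R \<and> I \<subseteq> \<Union> (P i)"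
      using primeideal_Union_quot[OF I P(1)] by blast
    moreover have "\<forall>i < l. \<Union> (P i) \<subset> \<Union> (P (Suc i))"
      using Union_psubset_quot[OF I P(1) P(1) P(2)] by simp
    ultimately show ?R by (rule exI[of _ "\<lambda>i. \<Union> (P i)", OF conjI])
  next
    assume ?R
    then obtain P :: "nat \<Rightarrow> 'a set" where P: "\<And>i. i \<le> l \<Longrightarrow> primeideal (P i) R"
      "\<And>i. i \<le> l \<Longrightarrow> I \<subseteq> P i" "\<And>i. i < l \<Longrightarrow> P i \<subset> P (Suc i)" by blast
    have "\<forall>i \<le> l. primeideal ((+>) I ` P i) (R Quot I)"
      using primeideal_image_quot(1)[OF I P(1,2)] by blast
    moreover have "(+>) I ` P i \<subset> (+>) I ` P (Suc i)" if i: "i < l" for i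
    proof -
      have le: "i \<le> l" "Suc i \<le> l" using i by auto
      show ?thesis
      proof (rule psubsetI)
        show "(+>) I ` P i \<subseteq> (+>) I ` P (Suc i)" using P(3)[OF i] by blast
        show "(+>) I ` P i \<noteq> (+>) I ` P (Suc i)"
        proof
          assume eq: "(+>) I ` P i = (+>) I ` P (Suc i)"
          have "P i = P (Suc i)"
            using primeideal_image_quot(2)[OF I P(1,2)[OF le(1)]]
              primeideal_image_quot(2)[OF I P(1,2)[OF le(2)]] unfolding eq by (rule trans[OF sym])
          then show False using P(3)[OF i] by blast
        qed
      qed
    qed
    moreover have "\<forall>i \<le> l. primeideal ((+>) I ` P i) (R Quot I)"
      using primeideal_image_quot(1)[OF I P(1,2)] by blast
    ultimately show ?L by (intro exI[of _ "\<lambda>i. (+>) I ` P i"] conjI) blast+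
  qed
  then show ?thesis by (simp add: krull_dim_def)
qed

section \<open>Monomials and substitution homomorphisms\<close>

text \<open>Monomials are handled as multisets of variables: products become unions, proofs go by
  induction on single factors, and the row and column sums of a monomial become image multisets
  under \<open>fst\<close> and \<open>snd\<close>.\<close>

definition expo :: "'v multiset \<Rightarrow> ('v \<Rightarrow>\<^sub>0 nat)" where
  "expo M = (\<Sum>v\<in>#M. Poly_Mapping.single v 1)"

lemma expo_empty [simp]: "expo {#} = 0"
  and expo_add_mset: "expo (add_mset v M) = Poly_Mapping.single v 1 + expo M"
  and expo_union: "expo (M + N) = expo M + expo N"
  by (simp_all add: expo_def)

lemma lookup_expo [simp]: "Poly_Mapping.lookup (expo M) v = count M v"
  by (induction M) (auto simp: expo_add_mset lookup_add lookup_single when_def)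

lemma keys_expo [simp]: "Poly_Mapping.keys (expo M) = set_mset M"
  by (auto simp: in_keys_iff)

lemma expo_cases: obtains M where "t = expo M"
proof -
  have "t = expo (Abs_multiset (Poly_Mapping.lookup t))"
    by (rule poly_mapping_eqI) (simp add: count_Abs_multiset)
  then show ?thesis using that by blast
qed

abbreviation mpoly_const :: "'k \<Rightarrow> ('v, 'k::comm_ring_1) mpoly" where
  "mpoly_const c \<equiv> Poly_Mapping.single 0 c"

abbreviation monom :: "'v multiset \<Rightarrow> ('v, 'k::comm_ring_1) mpoly" where
  "monom M \<equiv> Poly_Mapping.single (expo M) 1"

lemma monom_add_mset: "monom (add_mset v M) = mpoly_var v * monom M"
  by (simp add: mpoly_var_def mult_single expo_add_mset)

lemma monom_union: "monom (M + N) = monom M * monom N"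
  by (simp add: mult_single expo_union)

lemma mpoly_eq_sum_single:
  "p = (\<Sum>t\<in>Poly_Mapping.keys p. Poly_Mapping.single t (Poly_Mapping.lookup p t))"
  by (rule poly_mapping_eqI)
    (auto simp: lookup_sum lookup_single when_def in_keys_iff)

lemma keys_sum_mpoly: "Poly_Mapping.keys (sum f A) \<subseteq> (\<Union>a\<in>A. Poly_Mapping.keys (f a))"
  by (induction A rule: infinite_finite_induct) (use Poly_Mapping.keys_add in fastforce)+

definition expo_eval :: "('v \<Rightarrow> 'a::comm_monoid_mult) \<Rightarrow> ('v \<Rightarrow>\<^sub>0 nat) \<Rightarrow> 'a" where
  "expo_eval \<sigma> t = (\<Prod>v\<in>Poly_Mapping.keys t. \<sigma> v ^ Poly_Mapping.lookup t v)"

definition mpoly_eval ::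
  "('v \<Rightarrow> ('w, 'k) mpoly) \<Rightarrow> ('v, 'k::comm_ring_1) mpoly \<Rightarrow> ('w, 'k) mpoly" where
  "mpoly_eval \<sigma> p =
    (\<Sum>t\<in>Poly_Mapping.keys p. mpoly_const (Poly_Mapping.lookup p t) * expo_eval \<sigma> t)"

lemma expo_eval_superset:
  assumes "finite V" "Poly_Mapping.keys t \<subseteq> V"
  shows "expo_eval \<sigma> t = (\<Prod>v\<in>V. \<sigma> v ^ Poly_Mapping.lookup t v)"
  unfolding expo_eval_def
  by (rule prod.mono_neutral_left) (use assms in \<open>auto simp: in_keys_iff\<close>)

lemma expo_eval_add: "expo_eval \<sigma> (s + t) = expo_eval \<sigma> s * expo_eval \<sigma> t"
proof -
  let ?V = "Poly_Mapping.keys s \<union> Poly_Mapping.keys t"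
  have "Poly_Mapping.keys (s + t) \<subseteq> ?V" by (rule Poly_Mapping.keys_add)
  then show ?thesis
    by (simp add: expo_eval_superset[of ?V] lookup_add power_add prod.distrib)
qed

lemma expo_eval_zero [simp]: "expo_eval \<sigma> 0 = 1"
  and expo_eval_single [simp]: "expo_eval \<sigma> (Poly_Mapping.single v (Suc 0)) = \<sigma> v"
  by (simp_all add: expo_eval_def)

lemma expo_eval_expo: "expo_eval \<sigma> (expo M) = (\<Prod>v\<in>#M. \<sigma> v)"
  by (induction M) (simp_all add: expo_add_mset expo_eval_add)

lemma mpoly_eval_superset:
  assumes "finite T" "Poly_Mapping.keys p \<subseteq> T"
  shows "mpoly_eval \<sigma> p = (\<Sum>t\<in>T. mpoly_const (Poly_Mapping.lookup p t) * expo_eval \<sigma> t)"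
  unfolding mpoly_eval_def
  by (rule sum.mono_neutral_left) (use assms in \<open>auto simp: in_keys_iff\<close>)

lemma mpoly_eval_zero [simp]: "mpoly_eval \<sigma> 0 = 0"
  by (simp add: mpoly_eval_def)

lemma mpoly_eval_add: "mpoly_eval \<sigma> (p + q) = mpoly_eval \<sigma> p + mpoly_eval \<sigma> q"
proof -
  let ?T = "Poly_Mapping.keys p \<union> Poly_Mapping.keys q"
  have "Poly_Mapping.keys (p + q) \<subseteq> ?T" by (rule Poly_Mapping.keys_add)
  then show ?thesis
    by (simp add: mpoly_eval_superset[of ?T] lookup_add single_add distrib_right sum.distrib)
qed

lemma mpoly_eval_uminus: "mpoly_eval \<sigma> (- p) = - mpoly_eval \<sigma> p"
  using mpoly_eval_add[of \<sigma> p "- p"] by (simp add: eq_neg_iff_add_eq_0 add.commute)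

lemma mpoly_eval_diff: "mpoly_eval \<sigma> (p - q) = mpoly_eval \<sigma> p - mpoly_eval \<sigma> q"
  using mpoly_eval_add[of \<sigma> p "- q"] by (simp add: mpoly_eval_uminus)

lemma mpoly_eval_sum: "mpoly_eval \<sigma> (sum f A) = (\<Sum>a\<in>A. mpoly_eval \<sigma> (f a))"
  by (induction A rule: infinite_finite_induct) (simp_all add: mpoly_eval_add)

lemma mpoly_eval_single: "mpoly_eval \<sigma> (Poly_Mapping.single t c) = mpoly_const c * expo_eval \<sigma> t"
  by (simp add: mpoly_eval_def)

lemma mpoly_eval_var [simp]: "mpoly_eval \<sigma> (mpoly_var v) = \<sigma> v"
  by (simp add: mpoly_var_def mpoly_eval_single)

lemma mpoly_eval_one [simp]: "mpoly_eval \<sigma> 1 = 1"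
  using mpoly_eval_single[of \<sigma> 0 1] by simp

lemma mpoly_eval_mult: "mpoly_eval \<sigma> (p * q) = mpoly_eval \<sigma> p * mpoly_eval \<sigma> q"
proof -
  have 1: "mpoly_eval \<sigma> (Poly_Mapping.single s c * Poly_Mapping.single t d) =
    mpoly_eval \<sigma> (Poly_Mapping.single s c) * mpoly_eval \<sigma> (Poly_Mapping.single t d)" for s t c d
  proof -
    have "mpoly_eval \<sigma> (Poly_Mapping.single s c * Poly_Mapping.single t d) =
        mpoly_const (c * d) * (expo_eval \<sigma> s * expo_eval \<sigma> t)"
      by (simp only: mult_single mpoly_eval_single expo_eval_add)
    also have "\<dots> = (mpoly_const c * mpoly_const d) * (expo_eval \<sigma> s * expo_eval \<sigma> t)"
      by (simp add: mult_single)
    also have "\<dots> = (mpoly_const c * expo_eval \<sigma> s) * (mpoly_const d * expo_eval \<sigma> t)"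
      by (simp only: ac_simps)
    finally show ?thesis by (simp only: mpoly_eval_single)
  qed
  have "p * q = (\<Sum>s\<in>Poly_Mapping.keys p. \<Sum>t\<in>Poly_Mapping.keys q.
    Poly_Mapping.single s (Poly_Mapping.lookup p s) * Poly_Mapping.single t (Poly_Mapping.lookup q t))"
    using arg_cong2[OF mpoly_eq_sum_single[of p] mpoly_eq_sum_single[of q], of "(*)"]
    unfolding sum_product .
  then have "mpoly_eval \<sigma> (p * q) =
    (\<Sum>s\<in>Poly_Mapping.keys p. mpoly_eval \<sigma> (Poly_Mapping.single s (Poly_Mapping.lookup p s))) *
    (\<Sum>t\<in>Poly_Mapping.keys q. mpoly_eval \<sigma> (Poly_Mapping.single t (Poly_Mapping.lookup q t)))"
    by (simp add: mpoly_eval_sum 1 sum_product)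
  then show ?thesis
    by (simp flip: mpoly_eval_sum mpoly_eq_sum_single)
qed

lemma mpoly_eval_cong:
  assumes "p \<in> carrier (mpoly_ring V)" "\<And>v. v \<in> V \<Longrightarrow> \<sigma> v = \<tau> v"
  shows "mpoly_eval \<sigma> p = mpoly_eval \<tau> p"
proof -
  have "expo_eval \<sigma> t = expo_eval \<tau> t" if "t \<in> Poly_Mapping.keys p" for t
    unfolding expo_eval_def
    by (intro prod.cong refl) (metis (no_types, lifting) assms subsetD that mpoly_ring_simps(1))
  then show ?thesis by (simp add: mpoly_eval_def)
qed

lemma mpoly_ring_closed:
  fixes p q :: "('v, 'k::comm_ring_1) mpoly"
  shows "0 \<in> carrier (mpoly_ring V :: ('v, 'k) mpoly ring)"
    and "1 \<in> carrier (mpoly_ring V :: ('v, 'k) mpoly ring)"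
    and "p \<in> carrier (mpoly_ring V) \<Longrightarrow> q \<in> carrier (mpoly_ring V) \<Longrightarrow> p + q \<in> carrier (mpoly_ring V)"
    and "p \<in> carrier (mpoly_ring V) \<Longrightarrow> q \<in> carrier (mpoly_ring V) \<Longrightarrow> p * q \<in> carrier (mpoly_ring V)"
    and "p \<in> carrier (mpoly_ring V) \<Longrightarrow> - p \<in> carrier (mpoly_ring V)"
proof -
  interpret cring "mpoly_ring V :: ('v, 'k) mpoly ring" by (rule cring_mpoly_ring)
  show "0 \<in> carrier (mpoly_ring V :: ('v, 'k) mpoly ring)"
    using zero_closed by (simp add: mpoly_ring_simps)
  show "1 \<in> carrier (mpoly_ring V :: ('v, 'k) mpoly ring)"
    using one_closed by (simp add: mpoly_ring_simps)
  show "p \<in> carrier (mpoly_ring V) \<Longrightarrow> q \<in> carrier (mpoly_ring V) \<Longrightarrow> p + q \<in> carrier (mpoly_ring V)"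
    using a_closed[of p q] by (simp add: mpoly_ring_simps(2-))
  show "p \<in> carrier (mpoly_ring V) \<Longrightarrow> q \<in> carrier (mpoly_ring V) \<Longrightarrow> p * q \<in> carrier (mpoly_ring V)"
    using m_closed[of p q] by (simp add: mpoly_ring_simps(2-))
  show "p \<in> carrier (mpoly_ring V) \<Longrightarrow> - p \<in> carrier (mpoly_ring V)"
    by (simp add: mpoly_ring_simps)
qed

lemma mpoly_ring_closed_sum:
  "(\<And>a. a \<in> A \<Longrightarrow> f a \<in> carrier (mpoly_ring V)) \<Longrightarrow> sum f A \<in> carrier (mpoly_ring V)"
  by (induction A rule: infinite_finite_induct) (auto intro: mpoly_ring_closed)

lemma mpoly_const_in_carrier: "mpoly_const c \<in> carrier (mpoly_ring V)"
  by (simp add: mpoly_ring_simps)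

lemma mpoly_eval_closed:
  assumes "p \<in> carrier (mpoly_ring V)" "\<And>v. v \<in> V \<Longrightarrow> \<sigma> v \<in> carrier (mpoly_ring W)"
  shows "mpoly_eval \<sigma> p \<in> carrier (mpoly_ring W)"
  unfolding mpoly_eval_def
proof (intro mpoly_ring_closed_sum mpoly_ring_closed(4) mpoly_const_in_carrier)
  fix t assume t: "t \<in> Poly_Mapping.keys p"
  obtain M where M: "t = expo M" by (rule expo_cases)
  have "set_mset M \<subseteq> V" using t assms(1) M by (fastforce simp: mpoly_ring_simps)
  then have "(\<Prod>v\<in>#M. \<sigma> v) \<in> carrier (mpoly_ring W)"
    using assms(2) by (induction M) (auto intro: mpoly_ring_closed)
  then show "expo_eval \<sigma> t \<in> carrier (mpoly_ring W)" by (simp add: M expo_eval_expo)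
qed

lemma mpoly_ring_idealI:
  fixes I :: "('v, 'k::comm_ring_1) mpoly set"
  assumes "I \<subseteq> carrier (mpoly_ring V)" "0 \<in> I" "\<And>p q. p \<in> I \<Longrightarrow> q \<in> I \<Longrightarrow> p + q \<in> I"
    and mult: "\<And>p q. p \<in> I \<Longrightarrow> q \<in> carrier (mpoly_ring V) \<Longrightarrow> p * q \<in> I"
  shows "ideal I (mpoly_ring V)"
proof -
  interpret S: cring "mpoly_ring V :: ('v, 'k) mpoly ring" by (rule cring_mpoly_ring)
  show ?thesis
  proof (rule idealI[OF S.ring_axioms])
    show "subgroup I (add_monoid (mpoly_ring V))"
    proof (rule S.add.subgroupI)
      fix p assume p: "p \<in> I"
      have pc: "p \<in> carrier (mpoly_ring V)" using p assms(1) by auto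
      have "\<ominus>\<^bsub>mpoly_ring V\<^esub> p = - p"
        using S.minus_equality[of "- p" p] pc mpoly_ring_closed(5)[OF pc]
        by (simp add: mpoly_ring_simps(2-))
      moreover have "p * (- 1) \<in> I"
        by (rule mult[OF p]) (intro mpoly_ring_closed)
      ultimately show "\<ominus>\<^bsub>mpoly_ring V\<^esub> p \<in> I" by simp
    next
      show "I \<subseteq> carrier (mpoly_ring V)" using assms(1) by simp
      show "I \<noteq> {}" using assms(2) by blast
    qed (use assms(3) in \<open>simp add: mpoly_ring_simps(2-)\<close>)
  qed (use mult in \<open>auto simp: mpoly_ring_simps(2-) mult.commute\<close>)
qed

lemma ideal_mpoly_ringD:
  fixes I :: "('v, 'k::comm_ring_1) mpoly set"
  assumes "ideal I (mpoly_ring V)"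
  shows "I \<subseteq> carrier (mpoly_ring V)" "0 \<in> I" "\<And>p q. p \<in> I \<Longrightarrow> q \<in> I \<Longrightarrow> p + q \<in> I"
    "\<And>p q. p \<in> I \<Longrightarrow> q \<in> carrier (mpoly_ring V) \<Longrightarrow> p * q \<in> I"
    "\<And>p q. p \<in> I \<Longrightarrow> q \<in> carrier (mpoly_ring V) \<Longrightarrow> q * p \<in> I"
    "\<And>p. p \<in> I \<Longrightarrow> - p \<in> I"
    "\<And>p q. p \<in> I \<Longrightarrow> q \<in> I \<Longrightarrow> p - q \<in> I"
    "\<And>f A. (\<And>a. a \<in> A \<Longrightarrow> f a \<in> I) \<Longrightarrow> sum f A \<in> I"
proof -
  interpret I: ideal I "mpoly_ring V :: ('v, 'k) mpoly ring" by fact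
  show "I \<subseteq> carrier (mpoly_ring V)" by (rule I.a_subset)
  show zero: "0 \<in> I" using additive_subgroup.zero_closed[OF I.additive_subgroup_axioms] by (simp only: mpoly_ring_simps)
  show add: "p + q \<in> I" if "p \<in> I" "q \<in> I" for p q
    using additive_subgroup.a_closed[OF I.additive_subgroup_axioms that] by (simp only: mpoly_ring_simps)
  show mult: "p * q \<in> I" if "p \<in> I" "q \<in> carrier (mpoly_ring V)" for p q
    using I.I_r_closed[OF that] by (simp only: mpoly_ring_simps)
  then show "q * p \<in> I" if "p \<in> I" "q \<in> carrier (mpoly_ring V)" for p q
    using that by (simp only: mult.commute)
  show neg: "- p \<in> I" if "p \<in> I" for p
    using mult[OF that mpoly_ring_closed(5)[OF mpoly_ring_closed(2)]] by simp
  show "p - q \<in> I" if "p \<in> I" "q \<in> I" for p q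
    using add[OF that(1) neg[OF that(2)]] by simp
  show "sum f A \<in> I" if "\<And>a. a \<in> A \<Longrightarrow> f a \<in> I" for f A
    using that by (induction A rule: infinite_finite_induct) (auto intro: zero add)
qed

section \<open>Prime ideals of polynomial rings\<close>

definition kill :: "'v set \<Rightarrow> 'v \<Rightarrow> ('v, 'k::comm_ring_1) mpoly" where
  "kill W v = (if v \<in> W then 0 else mpoly_var v)"

lemma expo_eval_kill:
  "expo_eval (kill W :: 'v \<Rightarrow> ('v, 'k::comm_ring_1) mpoly) t = (if Poly_Mapping.keys t \<inter> W = {} then Poly_Mapping.single t 1 else 0)"
proof -
  obtain M where M: "t = expo M" by (rule expo_cases)
  have "(\<Prod>v\<in>#M. kill W v :: ('v, 'k) mpoly) = (if set_mset M \<inter> W = {} then monom M else 0)"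
  proof (induction M)
    case (add v M)
    then show ?case by (simp add: monom_add_mset kill_def)
  qed simp
  then show ?thesis by (simp add: M expo_eval_expo)
qed

text \<open>Each monomial is either kept or erased, so distinct terms cannot cancel.\<close>

lemma mpoly_eval_kill_eq_0_iff:
  "mpoly_eval (kill W) p = 0 \<longleftrightarrow> (\<forall>t\<in>Poly_Mapping.keys p. Poly_Mapping.keys t \<inter> W \<noteq> {})"
proof -
  have "Poly_Mapping.lookup (mpoly_eval (kill W) p) t =
    (if Poly_Mapping.keys t \<inter> W = {} then Poly_Mapping.lookup p t else 0)" for t
  proof -
    have "Poly_Mapping.lookup (mpoly_eval (kill W) p) t = (\<Sum>s\<in>Poly_Mapping.keys p.
      if s = t then (if Poly_Mapping.keys t \<inter> W = {} then Poly_Mapping.lookup p t else 0) else 0)"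
      unfolding mpoly_eval_def lookup_sum expo_eval_kill
      by (rule sum.cong) (auto simp: mult_single lookup_single when_def)
    then show ?thesis by (auto simp: in_keys_iff)
  qed
  then show ?thesis
    by (auto simp: poly_mapping_eq_iff fun_eq_iff in_keys_iff)
qed

text \<open>The kernel of substituting \<open>\<sigma>\<close> and then setting the variables in \<open>W\<close> to zero.\<close>

definition subst_ideal ::
  "'v set \<Rightarrow> ('v \<Rightarrow> ('w, 'k) mpoly) \<Rightarrow> 'w set \<Rightarrow> ('v, 'k::comm_ring_1) mpoly set" where
  "subst_ideal V \<sigma> W = {p \<in> carrier (mpoly_ring V).
    \<forall>t\<in>Poly_Mapping.keys (mpoly_eval \<sigma> p). Poly_Mapping.keys t \<inter> W \<noteq> {}}"

text \<open>A kernel of a homomorphism into a domain. The linear order on the target variables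
  orders the monomials, which is how the target polynomial ring is known to have no zero
  divisors.\<close>

lemma primeideal_subst_ideal:
  fixes \<sigma> :: "'v \<Rightarrow> ('w::linorder, 'k::field) mpoly"
  shows "primeideal (subst_ideal V \<sigma> W) (mpoly_ring V)"
proof -
  define h where "h p = mpoly_eval (kill W) (mpoly_eval \<sigma> p)" for p
  have h: "h (p + q) = h p + h q" "h (p * q) = h p * h q" "h 0 = 0" "h 1 = 1" for p q
    by (simp_all add: h_def mpoly_eval_add mpoly_eval_mult)
  have eq: "subst_ideal V \<sigma> W = {p \<in> carrier (mpoly_ring V). h p = 0}"
    by (simp add: subst_ideal_def h_def mpoly_eval_kill_eq_0_iff)
  have "ideal (subst_ideal V \<sigma> W) (mpoly_ring V)"
    unfolding eq by (rule mpoly_ring_idealI) (auto simp: h intro: mpoly_ring_closed)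
  then show ?thesis
  proof (rule primeidealI[OF _ cring_mpoly_ring])
    have "(1 :: ('v, 'k) mpoly) \<in> carrier (mpoly_ring V)" by (rule mpoly_ring_closed)
    moreover have "h 1 \<noteq> 0" using h(4) by simp
    ultimately show "carrier (mpoly_ring V) \<noteq> subst_ideal V \<sigma> W"
      unfolding eq by blast
  qed (auto simp: eq h mpoly_ring_simps(2-))
qed

lemma subst_ideal_mono: "W \<subseteq> W' \<Longrightarrow> subst_ideal V \<sigma> W \<subseteq> subst_ideal V \<sigma> W'"
  by (auto simp: subst_ideal_def)

lemma subst_ideal_empty: "subst_ideal V \<sigma> {} = {p \<in> carrier (mpoly_ring V). mpoly_eval \<sigma> p = 0}"
  by (auto simp: subst_ideal_def)

lemma mpoly_eval_mpoly_var [simp]: "mpoly_eval mpoly_var p = (p :: ('v, 'k::comm_ring_1) mpoly)"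
proof -
  have "expo_eval mpoly_var t = (Poly_Mapping.single t 1 :: ('v, 'k) mpoly)" for t
    using expo_eval_kill[of "{}" t] by (simp add: kill_def[abs_def])
  then have "mpoly_eval mpoly_var p =
      (\<Sum>t\<in>Poly_Mapping.keys p. Poly_Mapping.single t (Poly_Mapping.lookup p t))"
    by (simp add: mpoly_eval_def mult_single)
  then show ?thesis by (simp only: flip: mpoly_eq_sum_single)
qed

text \<open>A monomial meeting \<open>U\<close> is a multiple of a variable in \<open>U\<close>, so
  membership is settled term by term. Substituting \<open>mpoly_var\<close> is the identity. The
  right-hand side is shown to be an ideal directly, as the variables carry no order here.\<close>

lemma genideal_variables:
  fixes U V :: "'v set"
  defines "G \<equiv> (mpoly_var ` U :: ('v, 'k::field) mpoly set)"
  assumes "U \<subseteq> V"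
  shows "genideal (mpoly_ring V) G = subst_ideal V mpoly_var U"
proof
  interpret S: cring "mpoly_ring V :: ('v, 'k) mpoly ring" by (rule cring_mpoly_ring)
  have G: "G \<subseteq> carrier (mpoly_ring V)"
    using assms(2) unfolding G_def by (auto intro: mpoly_var_in_carrier)
  note D = ideal_mpoly_ringD[OF S.genideal_ideal[OF G]]
  have "ideal (subst_ideal V mpoly_var U :: ('v, 'k) mpoly set) (mpoly_ring V)"
  proof (rule mpoly_ring_idealI)
    fix p q :: "('v, 'k) mpoly"
    assume pq: "p \<in> subst_ideal V mpoly_var U" "q \<in> subst_ideal V mpoly_var U"
    show "p + q \<in> subst_ideal V mpoly_var U"
      using pq Poly_Mapping.keys_add[of p q]
      by (auto simp: subst_ideal_def intro: mpoly_ring_closed)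
  next
    fix p q :: "('v, 'k) mpoly"
    assume p: "p \<in> subst_ideal V mpoly_var U" and q: "q \<in> carrier (mpoly_ring V)"
    have "Poly_Mapping.keys t \<inter> U \<noteq> {}" if t: "t \<in> Poly_Mapping.keys (p * q)" for t
    proof -
      obtain a b where ab: "t = a + b" "a \<in> Poly_Mapping.keys p"
        using keys_mult[of p q] t by auto
      then have "Poly_Mapping.keys a \<inter> U \<noteq> {}" using p by (auto simp: subst_ideal_def)
      then show ?thesis using ab by (auto simp: in_keys_iff lookup_add)
    qed
    then show "p * q \<in> subst_ideal V mpoly_var U"
      using p q by (auto simp: subst_ideal_def intro: mpoly_ring_closed)
  qed (auto simp: subst_ideal_def intro: mpoly_ring_closed)
  then show "genideal (mpoly_ring V) G \<subseteq> subst_ideal V mpoly_var U"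
  proof (rule S.genideal_minimal)
    show "G \<subseteq> subst_ideal V mpoly_var U"
      using assms(2) mpoly_var_in_carrier[of _ V]
      by (auto simp: G_def subst_ideal_def mpoly_var_def)
  qed
  show "subst_ideal V mpoly_var U \<subseteq> genideal (mpoly_ring V) G"
  proof
    fix p :: "('v, 'k) mpoly" assume p: "p \<in> subst_ideal V mpoly_var U"
    have "Poly_Mapping.single t (Poly_Mapping.lookup p t) \<in> genideal (mpoly_ring V) G"
      if t: "t \<in> Poly_Mapping.keys p" for t
    proof -
      obtain M where M: "t = expo M" by (rule expo_cases)
      have MV: "set_mset M \<subseteq> V" "set_mset M \<inter> U \<noteq> {}"
        using t p unfolding M subst_ideal_def mpoly_ring_simps by (fastforce, fastforce)
      then obtain v where v: "v \<in> U" "v \<in># M" by auto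
      then obtain N where N: "M = add_mset v N" by (metis insert_DiffM)
      have "Poly_Mapping.single t (Poly_Mapping.lookup p t) =
          mpoly_var v * Poly_Mapping.single (expo N) (Poly_Mapping.lookup p t)"
        by (simp add: M N mpoly_var_def mult_single expo_add_mset)
      moreover have "mpoly_var v \<in> genideal (mpoly_ring V) G"
        using S.genideal_self[OF G] v by (auto simp: G_def)
      moreover have "Poly_Mapping.single (expo N) c \<in> carrier (mpoly_ring V)" for c :: 'k
        using MV N by (auto simp: mpoly_ring_simps split: if_splits)
      ultimately show ?thesis using D(4) by simp
    qed
    then show "p \<in> genideal (mpoly_ring V) G"
      by (subst mpoly_eq_sum_single) (rule D(8))
  qed
qed

section \<open>Chains of primes and algebraic independence\<close>

lemma keys_single_subset: "Poly_Mapping.keys (Poly_Mapping.single t c) \<subseteq> {t}"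
  by simp

text \<open>Division by \<open>x\<close>: \<open>h0\<close> collects the terms free of
  \<open>x\<close>, and \<open>h1\<close> the others with one factor \<open>x\<close> removed. The
  last clause says that this lowers the degree in \<open>x\<close>.\<close>

lemma split_variable:
  fixes g :: "('v, 'k::comm_ring_1) mpoly"
  obtains h0 h1 where "g = h0 + mpoly_var x * h1"
    and "\<And>t. t \<in> Poly_Mapping.keys h0 \<Longrightarrow> t \<in> Poly_Mapping.keys g \<and> Poly_Mapping.lookup t x = 0"
    and "\<And>t. t \<in> Poly_Mapping.keys h1 \<Longrightarrow> t + Poly_Mapping.single x 1 \<in> Poly_Mapping.keys g"
proof
  let ?K = "Poly_Mapping.keys g" and ?c = "Poly_Mapping.lookup g"
  define T0 T1 where "T0 = {t \<in> ?K. Poly_Mapping.lookup t x = 0}"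
    and "T1 = {t \<in> ?K. Poly_Mapping.lookup t x \<noteq> 0}"
  define h0 where "h0 = (\<Sum>t\<in>T0. Poly_Mapping.single t (?c t))"
  define h1 where "h1 = (\<Sum>t\<in>T1. Poly_Mapping.single (t - Poly_Mapping.single x 1) (?c t))"
  have shift: "t - Poly_Mapping.single x 1 + Poly_Mapping.single x 1 = t" if "t \<in> T1" for t
    using that by (intro poly_mapping_eqI)
      (auto simp: T1_def lookup_add lookup_minus lookup_single when_def)
  have "mpoly_var x * h1 = (\<Sum>t\<in>T1. Poly_Mapping.single t (?c t))"
    unfolding h1_def sum_distrib_left
    by (rule sum.cong[OF refl])
      (use shift in \<open>simp add: mpoly_var_def mult_single add.commute del: One_nat_def\<close>)
  moreover have "?K = T0 \<union> T1" "T0 \<inter> T1 = {}" "finite T0" "finite T1"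
    by (auto simp: T0_def T1_def)
  then have "(\<Sum>t\<in>?K. Poly_Mapping.single t (?c t)) =
      h0 + (\<Sum>t\<in>T1. Poly_Mapping.single t (?c t))"
    by (simp add: h0_def sum.union_disjoint)
  ultimately show "g = h0 + mpoly_var x * h1"
    using mpoly_eq_sum_single[of g] by simp
  have "Poly_Mapping.keys h0 \<subseteq> T0"
    unfolding h0_def by (rule order.trans[OF keys_sum_mpoly]) (use keys_single_subset in fast)
  then show "t \<in> ?K \<and> Poly_Mapping.lookup t x = 0" if "t \<in> Poly_Mapping.keys h0" for t
    using that by (auto simp: T0_def)
  have "Poly_Mapping.keys h1 \<subseteq> (\<lambda>t. t - Poly_Mapping.single x 1) ` T1"
    unfolding h1_def by (rule order.trans[OF keys_sum_mpoly]) (use keys_single_subset in fast)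
  then show "t + Poly_Mapping.single x 1 \<in> ?K" if "t \<in> Poly_Mapping.keys h1" for t
    using that shift by (fastforce simp: T1_def)
qed

lemma mpoly_ring_empty:
  assumes "g \<in> carrier (mpoly_ring {})"
  obtains c where "g = mpoly_const c"
proof
  show "g = mpoly_const (Poly_Mapping.lookup g 0)"
    using assms by (intro poly_mapping_eqI)
      (auto simp: mpoly_ring_simps lookup_single when_def in_keys_iff)
qed

text \<open>If \<open>f\<close> works for the chain starting at \<open>P 1\<close> and \<open>a \<in> P 1 - P 0\<close>, then appending \<open>a\<close> works
  for the whole chain: dividing a relation by a power of the variable for \<open>a\<close> keeps it a
  relation modulo \<open>P 0\<close>, and then reducing modulo \<open>P 1\<close> kills \<open>a\<close>.\<close>

lemma prime_chain_independent:
  fixes P :: "nat \<Rightarrow> ('v, 'k::field) mpoly set"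
  assumes "\<And>i. i \<le> l \<Longrightarrow> primeideal (P i) (mpoly_ring V)" "\<And>i. i < l \<Longrightarrow> P i \<subset> P (Suc i)"
  shows "\<exists>f. (\<forall>i. f i \<in> carrier (mpoly_ring V)) \<and>
    (\<forall>g \<in> carrier (mpoly_ring {..<l}). mpoly_eval f g \<in> P 0 \<longrightarrow> g = 0)"
  using assms
proof (induction l arbitrary: P)
  case 0
  interpret P: primeideal "P 0" "mpoly_ring V" using 0 by simp
  note D = ideal_mpoly_ringD[OF P.ideal_axioms]
  \<comment> \<open>Without variables a relation is a constant, and a nonzero constant is a unit,
    which no prime contains.\<close>
  have "g = 0" if g: "g \<in> carrier (mpoly_ring {})" "mpoly_eval (\<lambda>_. 0) g \<in> P 0" for g :: "(nat, 'k) mpoly"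
  proof -
    obtain c where c: "g = mpoly_const c" using mpoly_ring_empty g(1) .
    have "c = 0"
    proof (rule ccontr)
      assume "c \<noteq> 0"
      have "mpoly_const c \<in> P 0" using g(2) c by (simp add: mpoly_eval_single)
      then have "mpoly_const (1 / c) * mpoly_const c \<in> P 0"
        by (rule D(5)) (rule mpoly_const_in_carrier)
      then have "1 \<in> P 0" using \<open>c \<noteq> 0\<close> by (simp add: mult_single)
      then have "P 0 = carrier (mpoly_ring V)"
        using P.one_imp_carrier by (simp add: mpoly_ring_simps(3))
      then show False using P.I_notcarr by simp
    qed
    then show ?thesis using c by simp
  qed
  then show ?case
    by (intro exI[of _ "\<lambda>_. 0"]) (simp add: mpoly_ring_closed)
next
  case (Suc l)
  obtain f where f: "\<And>i. f i \<in> carrier (mpoly_ring V)"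
    and ind: "\<And>g. g \<in> carrier (mpoly_ring {..<l}) \<Longrightarrow> mpoly_eval f g \<in> P 1 \<Longrightarrow> g = 0"
    using Suc.IH[of "\<lambda>i. P (Suc i)"] Suc.prems by (metis One_nat_def Suc_leI Suc_mono less_Suc_eq_le)
  obtain a where a: "a \<in> P 1" "a \<notin> P 0" using Suc.prems(2)[of 0] by auto
  have sub: "P 0 \<subseteq> P 1" using Suc.prems(2)[of 0] by auto
  interpret P0: primeideal "P 0" "mpoly_ring V" using Suc.prems by simp
  interpret P1: primeideal "P 1" "mpoly_ring V" using Suc.prems by simp
  note D1 = ideal_mpoly_ringD[OF P1.ideal_axioms]
  define f' where "f' = f(l := a)"
  have ac: "a \<in> carrier (mpoly_ring V)" using a D1(1) by auto
  have f': "f' i \<in> carrier (mpoly_ring V)" for i using f ac by (simp add: f'_def)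
  \<comment> \<open>Induction on the bound \<open>n\<close> for the degree in the variable
    \<open>l\<close>, which stands for \<open>a\<close>. Modulo \<open>P 1\<close> only the part
    \<open>h0\<close> free of this variable survives, so \<open>h0 = 0\<close>; then
    \<open>a\<close> cancels modulo \<open>P 0\<close>, leaving the relation \<open>h1\<close> of
    smaller degree.\<close>
  have "g = 0" if "g \<in> carrier (mpoly_ring {..<Suc l})" "mpoly_eval f' g \<in> P 0"
    "\<forall>t \<in> Poly_Mapping.keys g. Poly_Mapping.lookup t l < n" for g n
    using that
  proof (induction n arbitrary: g)
    case 0
    then show ?case by (metis equals0I keys_eq_empty not_less0)
  next
    case (Suc n)
    obtain h0 h1 where g: "g = h0 + mpoly_var l * h1"
      and h0: "\<And>t. t \<in> Poly_Mapping.keys h0 \<Longrightarrow> t \<in> Poly_Mapping.keys g \<and> Poly_Mapping.lookup t l = 0"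
      and h1: "\<And>t. t \<in> Poly_Mapping.keys h1 \<Longrightarrow> t + Poly_Mapping.single l 1 \<in> Poly_Mapping.keys g"
      using split_variable[of g l] by blast
    have h0c: "h0 \<in> carrier (mpoly_ring {..<l})"
      unfolding mpoly_ring_simps
    proof (intro ballI subsetI)
      fix t i assume t: "t \<in> Poly_Mapping.keys h0" and i: "i \<in> Poly_Mapping.keys t"
      have "i < Suc l" using Suc.prems(1) h0[OF t] i unfolding mpoly_ring_simps by blast
      moreover have "i \<noteq> l" using h0[OF t] i by (auto simp: in_keys_iff)
      ultimately show "i \<in> {..<l}" by simp
    qed
    have h1c: "h1 \<in> carrier (mpoly_ring {..<Suc l})"
      unfolding mpoly_ring_simps
    proof
      fix t assume t: "t \<in> Poly_Mapping.keys h1"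
      have "Poly_Mapping.keys t \<subseteq> Poly_Mapping.keys (t + Poly_Mapping.single l 1)"
        by (auto simp: in_keys_iff lookup_add)
      then show "Poly_Mapping.keys t \<subseteq> {..<Suc l}"
        using Suc.prems(1) h1[OF t] unfolding mpoly_ring_simps by blast
    qed
    have e1: "mpoly_eval f' h1 \<in> carrier (mpoly_ring V)"
      using h1c f' by (rule mpoly_eval_closed)
    have eg: "mpoly_eval f' g = mpoly_eval f' h0 + a * mpoly_eval f' h1"
      by (simp add: g mpoly_eval_add mpoly_eval_mult f'_def)
    have "mpoly_eval f' h0 = mpoly_eval f' g - a * mpoly_eval f' h1" using eg by simp
    also have "\<dots> \<in> P 1"
      using D1(7)[OF _ D1(4)[OF a(1) e1]] Suc.prems(2) sub by blast
    also have "mpoly_eval f' h0 = mpoly_eval f h0"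
      using h0c by (rule mpoly_eval_cong) (simp add: f'_def)
    finally have "h0 = 0" using ind[OF h0c] by simp
    then have "a * mpoly_eval f' h1 \<in> P 0" using eg Suc.prems(2) by simp
    then have "mpoly_eval f' h1 \<in> P 0"
      using P0.I_prime[OF ac e1] a(2) by (simp add: mpoly_ring_simps(2))
    moreover have "\<forall>t \<in> Poly_Mapping.keys h1. Poly_Mapping.lookup t l < n"
      using h1 Suc.prems(3) by (fastforce simp: lookup_add)
    ultimately have "h1 = 0" using Suc.IH h1c by blast
    then show ?case using g \<open>h0 = 0\<close> by simp
  qed
  moreover have "\<exists>n. \<forall>t \<in> Poly_Mapping.keys g. Poly_Mapping.lookup t l < n" for g :: "(nat, 'k) mpoly"
    using finite_nat_set_iff_bounded[of "(\<lambda>t. Poly_Mapping.lookup t l) ` Poly_Mapping.keys g"] by auto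
  ultimately show ?case using f' by (intro exI[of _ f']) blast
qed

section \<open>Linear dependence and counting of monomials\<close>

lemma nontrivial_relation:
  fixes v :: "'a \<Rightarrow> 'c \<Rightarrow> 'k::field"
  assumes "finite C" "finite A" "card C < card A"
  shows "\<exists>u. (\<exists>a\<in>A. u a \<noteq> 0) \<and> (\<forall>c\<in>C. (\<Sum>a\<in>A. u a * v a c) = 0)"
  using assms
proof (induction C arbitrary: A v rule: finite_induct)
  case empty
  then have "A \<noteq> {}" by auto
  then show ?case by (intro exI[of _ "\<lambda>_. 1"]) auto
next
  case (insert c C)
  show ?case
  proof (cases "\<forall>a\<in>A. v a c = 0")
    case True
    have "card C < card A" using insert by simp
    then obtain u where "\<exists>a\<in>A. u a \<noteq> 0" "\<forall>c\<in>C. (\<Sum>a\<in>A. u a * v a c) = 0"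
      using insert.IH[OF insert.prems(1)] by blast
    then show ?thesis using True by (intro exI[of _ u]) simp
  next
    case False
    then obtain b where b: "b \<in> A" "v b c \<noteq> 0" by auto
    \<comment> \<open>Gaussian elimination with pivot \<open>v b c\<close>: \<open>w\<close> clears
      the column \<open>c\<close>. Later \<open>u' b\<close> is the value that solves the equation
      for \<open>c\<close> given the other unknowns.\<close>
    define w where "w a d = v a d - v a c / v b c * v b d" for a d
    have "card C < card (A - {b})" using insert b by simp
    then obtain u where u: "\<exists>a\<in>A - {b}. u a \<noteq> 0" "\<And>d. d \<in> C \<Longrightarrow> (\<Sum>a\<in>A - {b}. u a * w a d) = 0"
      using insert.IH[of "A - {b}" w] insert.prems(1) by blast
    define u' where "u' = u(b := - (\<Sum>a\<in>A - {b}. u a * v a c) / v b c)"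
    have "(\<Sum>a\<in>A. u' a * v a d) = (\<Sum>a\<in>A - {b}. u a * w a d)" for d
    proof -
      have "(\<Sum>a\<in>A. u' a * v a d) = u' b * v b d + (\<Sum>a\<in>A - {b}. u' a * v a d)"
        using insert.prems(1) b(1) by (simp add: sum.remove)
      also have "(\<Sum>a\<in>A - {b}. u' a * v a d) = (\<Sum>a\<in>A - {b}. u a * v a d)"
        by (rule sum.cong) (auto simp: u'_def)
      also have "u' b * v b d = - (\<Sum>a\<in>A - {b}. u a * (v a c / v b c * v b d))"
        by (simp add: u'_def sum_distrib_right sum_divide_distrib mult.assoc)
      also have "\<dots> + (\<Sum>a\<in>A - {b}. u a * v a d) = (\<Sum>a\<in>A - {b}. u a * w a d)"
        by (simp add: w_def right_diff_distrib sum_subtractf)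
      finally show ?thesis .
    qed
    moreover have "w a c = 0" for a using b by (simp add: w_def)
    ultimately have "\<forall>d\<in>insert c C. (\<Sum>a\<in>A. u' a * v a d) = 0" using u(2) by auto
    moreover have "\<exists>a\<in>A. u' a \<noteq> 0" using u(1) by (auto simp: u'_def)
    ultimately show ?thesis by blast
  qed
qed

definition box :: "'v set \<Rightarrow> nat \<Rightarrow> ('v \<Rightarrow>\<^sub>0 nat) set" where
  "box V e = {t. Poly_Mapping.keys t \<subseteq> V \<and> (\<forall>v. Poly_Mapping.lookup t v < e)}"

lemma box_card:
  assumes "finite V" "e > 0"
  shows "finite (box V e)" "card (box V e) = e ^ card V"
proof -
  let ?f = "\<lambda>t::'a \<Rightarrow>\<^sub>0 nat. restrict (Poly_Mapping.lookup t) V"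
  have "bij_betw ?f (box V e) (PiE V (\<lambda>_. {..<e}))"
    unfolding bij_betw_def
  proof
    show "inj_on ?f (box V e)"
    proof (rule inj_onI, rule poly_mapping_eqI)
      fix s t v assume *: "s \<in> box V e" "t \<in> box V e" "?f s = ?f t"
      show "Poly_Mapping.lookup s v = Poly_Mapping.lookup t v"
      proof (cases "v \<in> V")
        case True
        then show ?thesis using fun_cong[OF *(3), of v] by simp
      next
        case False
        then have "v \<notin> Poly_Mapping.keys s" "v \<notin> Poly_Mapping.keys t" using * by (auto simp: box_def)
        then show ?thesis by (simp add: in_keys_iff)
      qed
    qed
    show "?f ` box V e = PiE V (\<lambda>_. {..<e})"
    proof
      show "?f ` box V e \<subseteq> PiE V (\<lambda>_. {..<e})" by (auto simp: box_def)
      show "PiE V (\<lambda>_. {..<e}) \<subseteq> ?f ` box V e"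
      proof
        fix g assume g: "g \<in> PiE V (\<lambda>_. {..<e})"
        define t where "t = Abs_poly_mapping (\<lambda>v. if v \<in> V then g v else 0)"
        have t: "Poly_Mapping.lookup t v = (if v \<in> V then g v else 0)" for v
          unfolding t_def using assms(1) by (subst lookup_Abs_poly_mapping) auto
        have "t \<in> box V e" using g assms by (auto simp: box_def t in_keys_iff split: if_splits)
        moreover have "g = ?f t"
          using g by (auto simp: t fun_eq_iff PiE_def extensional_def)
        ultimately show "g \<in> ?f ` box V e" by blast
      qed
    qed
  qed
  then show "finite (box V e)" "card (box V e) = e ^ card V"
    using assms by (simp_all add: bij_betw_finite bij_betw_same_card card_PiE finite_PiE)
qed

lemma lookup_mpoly_const_mult [simp]:
  "Poly_Mapping.lookup (mpoly_const c * p) t = c * Poly_Mapping.lookup p t"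
  by (simp add: map.rep_eq when_def flip: mult_map_scale_conv_mult)

lemma expo_eval_degree_bound:
  fixes F :: "'v \<Rightarrow> ('w, 'k::comm_ring_1) mpoly"
  assumes "\<And>v s w. v \<in># M \<Longrightarrow> s \<in> Poly_Mapping.keys (F v) \<Longrightarrow> Poly_Mapping.lookup s w \<le> D"
    and "s \<in> Poly_Mapping.keys (\<Prod>v\<in>#M. F v)"
  shows "Poly_Mapping.lookup s w \<le> D * size M"
  using assms
proof (induction M arbitrary: s)
  case (add v M)
  obtain a b where ab: "s = a + b" "a \<in> Poly_Mapping.keys (F v)" "b \<in> Poly_Mapping.keys (\<Prod>v\<in>#M. F v)"
    using keys_mult[of "F v" "\<Prod>v\<in>#M. F v"] add.prems(2) by auto
  have "Poly_Mapping.lookup a w \<le> D" using add.prems(1)[OF _ ab(2)] by simp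
  moreover have "Poly_Mapping.lookup b w \<le> D * size M" 
    by (rule add.IH) (use add.prems(1) ab(3) in auto)
  ultimately show ?case using ab(1) by (simp add: lookup_add)
qed simp

text \<open>The \<open>e ^ l\<close> monomials with exponents below \<open>e\<close> in \<open>F 0, \<dots>, F (l - 1)\<close> are linearly
  independent and lie in a space of dimension \<open>O(e ^ card W)\<close>.\<close>

lemma independent_le_card:
  fixes F :: "nat \<Rightarrow> ('w, 'k::field) mpoly"
  assumes W: "finite W" and F: "\<And>i. i < l \<Longrightarrow> F i \<in> carrier (mpoly_ring W)"
    and ind: "\<And>g. g \<in> carrier (mpoly_ring {..<l}) \<Longrightarrow> mpoly_eval F g = 0 \<Longrightarrow> g = 0"
  shows "l \<le> card W"
proof (rule ccontr)
  assume "\<not> l \<le> card W"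
  then have l: "Suc (card W) \<le> l" by simp
  have "finite (\<Union>i<l. \<Union>s\<in>Poly_Mapping.keys (F i). Poly_Mapping.range s)" by simp
  then obtain D where D: "\<forall>x \<in> (\<Union>i<l. \<Union>s\<in>Poly_Mapping.keys (F i). Poly_Mapping.range s). x \<le> D"
    using finite_nat_set_iff_bounded_le by meson
  have D: "Poly_Mapping.lookup s w \<le> D" if "i < l" "s \<in> Poly_Mapping.keys (F i)" for i s w
  proof (cases "w \<in> Poly_Mapping.keys s")
    case True
    then have "Poly_Mapping.lookup s w \<in> Poly_Mapping.range s" by (rule in_keys_lookup_in_range)
    then show ?thesis using D that by blast
  qed (simp add: in_keys_iff)
  \<comment> \<open>An exponent vector in \<open>?A\<close> has total degree at most
    \<open>l * e\<close>, and each \<open>F i\<close> has degree at most \<open>D\<close> in each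
    variable; hence the box \<open>?C\<close>. Its size is at most
    \<open>(D * l + 1) ^ card W * e ^ card W\<close>. This \<open>e\<close> exceeds the first
    factor, and \<open>l > card W\<close> provides the one extra power of \<open>e\<close> that
    beats it.\<close>
  define e where "e = (D * l + 1) ^ card W + 1"
  let ?A = "box {..<l} e" and ?C = "box W (D * (l * e) + 1)"
  have e: "e > 0" by (simp add: e_def)
  have "(D * (l * e) + 1) ^ card W \<le> ((D * l + 1) * e) ^ card W"
    by (rule power_mono) (simp_all add: e_def algebra_simps)
  also have "\<dots> = (D * l + 1) ^ card W * e ^ card W" by (rule power_mult_distrib)
  also have "\<dots> < e * e ^ card W" by (rule mult_strict_right_mono) (simp_all add: e_def)
  also have "\<dots> \<le> e ^ l" using power_increasing[OF l, of e] e by simp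
  finally have "card ?C < card ?A" 
    using box_card(2)[OF W, of "D * (l * e) + 1"] box_card(2)[OF finite_lessThan e, of l] by simp
  then obtain u where u: "\<exists>a\<in>?A. u a \<noteq> 0"
    "\<And>c. c \<in> ?C \<Longrightarrow> (\<Sum>a\<in>?A. u a * Poly_Mapping.lookup (expo_eval F a) c) = 0"
    using nontrivial_relation[of ?C ?A "\<lambda>a c. Poly_Mapping.lookup (expo_eval F a) c"]
      box_card(1)[OF W, of "D * (l * e) + 1"] box_card(1)[OF finite_lessThan e, of l] by auto
  define g where "g = (\<Sum>a\<in>?A. Poly_Mapping.single a (u a))"
  have lg: "Poly_Mapping.lookup g a = u a" if "a \<in> ?A" for a
    using that box_card(1)[OF _ e, of "{..<l}"]
    by (simp add: g_def lookup_sum lookup_single when_def)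
  have "g \<in> carrier (mpoly_ring {..<l})"
    unfolding g_def by (rule mpoly_ring_closed_sum) (auto simp: mpoly_ring_simps box_def)
  moreover have "mpoly_eval F g = 0"
  proof (rule poly_mapping_eqI)
    fix c
    have *: "Poly_Mapping.lookup (mpoly_eval F g) c =
      (\<Sum>a\<in>?A. u a * Poly_Mapping.lookup (expo_eval F a) c)"
      by (simp add: g_def mpoly_eval_sum mpoly_eval_single lookup_sum)
    \<comment> \<open>Coefficients outside \<open>?C\<close> vanish in every product, so the
      equations indexed by \<open>?C\<close> force the whole combination to be zero.\<close>
    have "c \<in> ?C" if a: "a \<in> ?A" and c: "c \<in> Poly_Mapping.keys (expo_eval F a)" for a
    proof -
      obtain M where M: "a = expo M" by (rule expo_cases)
      have Ml: "set_mset M \<subseteq> {..<l}" and Me: "\<And>v. count M v < e"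
        using a by (auto simp: M box_def)
      have "size M \<le> (\<Sum>v<l. count M v)"
        unfolding size_multiset_overloaded_eq by (rule sum_mono2) (use Ml in auto)
      also have "\<dots> \<le> (\<Sum>v<l. e)" by (rule sum_mono) (use Me in \<open>simp add: less_imp_le\<close>)
      finally have De: "D * size M \<le> D * (l * e)" by simp
      have "Poly_Mapping.lookup c w \<le> D * size M" for w
        by (rule expo_eval_degree_bound[of M F]) (use D Ml c in \<open>auto simp: M expo_eval_expo\<close>)
      then have "Poly_Mapping.lookup c w < D * (l * e) + 1" for w
        using order.trans[OF _ De] by (simp add: less_Suc_eq_le)
      moreover have "expo_eval F a \<in> carrier (mpoly_ring W)"
      proof -
        have "monom M \<in> carrier (mpoly_ring {..<l})" using Ml by (simp add: mpoly_ring_simps)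
        then have "mpoly_eval F (monom M) \<in> carrier (mpoly_ring W)"
          by (rule mpoly_eval_closed) (use F in auto)
        then show ?thesis by (simp add: mpoly_eval_single M)
      qed
      ultimately show ?thesis using c unfolding box_def mpoly_ring_simps by blast
    qed
    then have "\<forall>a\<in>?A. u a * Poly_Mapping.lookup (expo_eval F a) c = 0" if "c \<notin> ?C"
      using that by (metis in_keys_iff mult_zero_right)
    then have "Poly_Mapping.lookup (mpoly_eval F g) c = 0"
      unfolding * using u(2)[of c] by (cases "c \<in> ?C") (simp_all add: sum.neutral)
    then show "Poly_Mapping.lookup (mpoly_eval F g) c = Poly_Mapping.lookup 0 c" by simp
  qed
  ultimately have "g = 0" by (rule ind)
  then show False using u(1) lg by auto
qed

lemma mpoly_eval_mpoly_eval:
  "mpoly_eval \<sigma> (mpoly_eval f g) = mpoly_eval (\<lambda>v. mpoly_eval \<sigma> (f v)) g"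
proof -
  have "mpoly_eval \<sigma> (expo_eval f t) = expo_eval (\<lambda>v. mpoly_eval \<sigma> (f v)) t" for t
  proof -
    obtain M where M: "t = expo M" by (rule expo_cases)
    have "mpoly_eval \<sigma> (\<Prod>v\<in>#M. f v) = (\<Prod>v\<in>#M. mpoly_eval \<sigma> (f v))"
      by (induction M) (simp_all add: mpoly_eval_mult)
    then show ?thesis by (simp add: M expo_eval_expo)
  qed
  then show ?thesis
    unfolding mpoly_eval_def[of f g] mpoly_eval_def[of "\<lambda>v. mpoly_eval \<sigma> (f v)" g]
    by (simp add: mpoly_eval_sum mpoly_eval_mult mpoly_eval_single)
qed

text \<open>A relation among the images under \<open>\<sigma>\<close> of the elements extracted from
  the chain puts the same expression in the elements into the kernel of \<open>\<sigma>\<close>,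
  hence into \<open>P 0\<close>. So the images are algebraically independent in a polynomial ring
  with \<open>card W\<close> variables.\<close>

lemma prime_chain_le_card:
  fixes P :: "nat \<Rightarrow> ('v, 'k::field) mpoly set"
  assumes P: "\<And>i. i \<le> l \<Longrightarrow> primeideal (P i) (mpoly_ring V)" "\<And>i. i < l \<Longrightarrow> P i \<subset> P (Suc i)"
    and W: "finite W" and \<sigma>: "\<And>v. v \<in> V \<Longrightarrow> \<sigma> v \<in> carrier (mpoly_ring W)"
    and sub: "subst_ideal V \<sigma> {} \<subseteq> P 0"
  shows "l \<le> card W"
proof -
  obtain f where f: "\<And>i. f i \<in> carrier (mpoly_ring V)"
    and ind: "\<And>g. g \<in> carrier (mpoly_ring {..<l}) \<Longrightarrow> mpoly_eval f g \<in> P 0 \<Longrightarrow> g = 0"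
    using prime_chain_independent[of l P V] P by blast
  show ?thesis
  proof (rule independent_le_card[OF W])
    show "mpoly_eval \<sigma> (f i) \<in> carrier (mpoly_ring W)" for i
      using f \<sigma> by (rule mpoly_eval_closed)
    fix g :: "(nat, 'k) mpoly" assume g: "g \<in> carrier (mpoly_ring {..<l})"
      and 0: "mpoly_eval (\<lambda>i. mpoly_eval \<sigma> (f i)) g = 0"
    have "mpoly_eval f g \<in> carrier (mpoly_ring V)" using g f by (rule mpoly_eval_closed)
    then have "mpoly_eval f g \<in> subst_ideal V \<sigma> {}"
      using 0 by (simp add: subst_ideal_empty mpoly_eval_mpoly_eval)
    then show "g = 0" using ind g sub by blast
  qed
qed

text \<open>Moves the erasing of variables into the substitution, so that
  \<open>prime_chain_le_card\<close> applies to the column ideals.\<close>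

lemma subst_ideal_kill: "subst_ideal V mpoly_var U = subst_ideal V (kill U) {}"
  by (simp add: subst_ideal_empty) (simp add: subst_ideal_def mpoly_eval_kill_eq_0_iff)

text \<open>Separates consecutive primes of an explicit chain: the image of \<open>p\<close> is a
  single monomial, erased by \<open>W'\<close> but not by \<open>W\<close>.\<close>

lemma subst_ideal_psubset:
  fixes \<sigma> :: "'v \<Rightarrow> ('w, 'k::comm_ring_1) mpoly"
  assumes "W \<subseteq> W'" "p \<in> carrier (mpoly_ring V)" "mpoly_eval \<sigma> p = monom M"
    and "set_mset M \<inter> W = {}" "set_mset M \<inter> W' \<noteq> {}"
  shows "subst_ideal V \<sigma> W \<subset> subst_ideal V \<sigma> W'"
proof -
  have "p \<in> subst_ideal V \<sigma> W'" "p \<notin> subst_ideal V \<sigma> W"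
    using assms by (auto simp: subst_ideal_def)
  then show ?thesis using subst_ideal_mono[OF assms(1)] by blast
qed

section \<open>Binomials modulo generalized binomial edge ideals\<close>

text \<open>A binomial with the columns in the same class is reached through a third entry \<open>(p, q)\<close>
  in another class, just as a transposition \<open>(a b)\<close> is the product \<open>(a c) (b c) (a c)\<close>.\<close>

lemma swap_mem:
  fixes J :: "(nat \<times> nat, 'k::field) mpoly set" and c :: "nat \<Rightarrow> 'c"
  assumes J: "ideal J (matrix_ring m n)"
    and gen: "\<And>i j k l. i \<in> {1..m} \<Longrightarrow> j \<in> {1..m} \<Longrightarrow> k \<in> {1..n} \<Longrightarrow> l \<in> {1..n} \<Longrightarrow> c k \<noteq> c l \<Longrightarrow>
      mpoly_var (i, k) * mpoly_var (j, l) - mpoly_var (i, l) * mpoly_var (j, k) \<in> J"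
    and M: "set_mset M \<subseteq> {1..m} \<times> {1..n}"
    and ij: "i \<in> {1..m}" "j \<in> {1..m}" "k \<in> {1..n}" "l \<in> {1..n}"
    and mixed: "\<exists>v \<in># M + {#(i, k), (j, l)#}. \<exists>w \<in># M + {#(i, k), (j, l)#}. c (snd v) \<noteq> c (snd w)"
  shows "monom (M + {#(i, k), (j, l)#}) - monom (M + {#(i, l), (j, k)#}) \<in> J"
proof -
  note D = ideal_mpoly_ringD[OF J]
  have mon: "monom N \<in> carrier (matrix_ring m n)" if "set_mset N \<subseteq> {1..m} \<times> {1..n}" for N
    using that by (simp add: mpoly_ring_simps)
  show ?thesis
  proof (cases "c k = c l")
    case False
    have "monom M * (mpoly_var (i, k) * mpoly_var (j, l) - mpoly_var (i, l) * mpoly_var (j, k)) \<in> J"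
      using D(5) gen[OF ij False] mon[OF M] by blast
    then show ?thesis by (simp add: monom_add_mset algebra_simps)
  next
    case True
    then obtain p q where pq: "(p, q) \<in># M" "c q \<noteq> c k"
      using mixed by auto
    then obtain N where N: "M = add_mset (p, q) N" by (metis insert_DiffM)
    have p: "p \<in> {1..m}" "q \<in> {1..n}" using pq M by auto
    let ?x = "\<lambda>i k. mpoly_var (i, k) :: (nat \<times> nat, 'k) mpoly"
    have x: "?x a b \<in> carrier (matrix_ring m n)" if "a \<in> {1..m}" "b \<in> {1..n}" for a b
      using that by (intro mpoly_var_in_carrier) simp
    \<comment> \<open>The sum telescopes to \<open>?x p q\<close> times the desired minor. Each
      bracket is a generator, as it pairs column \<open>q\<close> with \<open>k\<close> or
      \<open>l\<close>, which are in another class.\<close>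
    have "?x j l * (?x i k * ?x p q - ?x i q * ?x p k) + ?x p k * (?x j l * ?x i q - ?x j q * ?x i l)
      + ?x i l * (?x p k * ?x j q - ?x p q * ?x j k) \<in> J"
      using ij p pq True by (intro D(3) D(5) gen x) auto
    then have "monom N * (?x j l * (?x i k * ?x p q - ?x i q * ?x p k)
      + ?x p k * (?x j l * ?x i q - ?x j q * ?x i l)
      + ?x i l * (?x p k * ?x j q - ?x p q * ?x j k)) \<in> J"
      using D(5) mon[of N] M N by auto
    then show ?thesis by (simp add: N monom_add_mset algebra_simps)
  qed
qed

text \<open>\<open>C\<close> holds the entries already matched. Each round moves one entry of
  \<open>D'\<close> into \<open>C\<close>, after creating it in \<open>D\<close> by a swap if
  necessary. The condition on classes refers to \<open>C + D\<close>, so that it survives when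
  \<open>D\<close> shrinks.\<close>

lemma equal_margins_mem:
  fixes J :: "(nat \<times> nat, 'k::field) mpoly set" and c :: "nat \<Rightarrow> 'c"
  assumes J: "ideal J (matrix_ring m n)"
    and gen: "\<And>i j k l. i \<in> {1..m} \<Longrightarrow> j \<in> {1..m} \<Longrightarrow> k \<in> {1..n} \<Longrightarrow> l \<in> {1..n} \<Longrightarrow> c k \<noteq> c l \<Longrightarrow>
      mpoly_var (i, k) * mpoly_var (j, l) - mpoly_var (i, l) * mpoly_var (j, k) \<in> J"
    and "set_mset (C + D + D') \<subseteq> {1..m} \<times> {1..n}"
    and "image_mset fst D = image_mset fst D'" "image_mset snd D = image_mset snd D'"
    and "\<exists>v \<in># C + D. \<exists>w \<in># C + D. c (snd v) \<noteq> c (snd w)"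
  shows "monom (C + D) - monom (C + D') \<in> J"
  using assms(3-)
proof (induction "size D" arbitrary: C D D')
  case 0
  then show ?case using ideal_mpoly_ringD(2)[OF J] by simp
next
  case (Suc d)
  obtain i k where ik: "(i, k) \<in># D" using Suc.hyps(2) by (metis size_eq_Suc_imp_elem surj_pair)
  have "i \<in># image_mset fst D'" using ik Suc.prems(2) by (metis fst_conv image_mset.compositionality
    image_eqI set_image_mset)
  then obtain l where il: "(i, l) \<in># D'" by auto
  have "l \<in># image_mset snd D" using il Suc.prems(3) by (metis snd_conv image_eqI set_image_mset)
  then obtain j where jl: "(j, l) \<in># D" by auto
  obtain D1' where D': "D' = add_mset (i, l) D1'" using il by (metis insert_DiffM)
  show ?case
  proof (cases "(i, l) \<in># D")
    case True
    then obtain D1 where D: "D = add_mset (i, l) D1" by (metis insert_DiffM)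
    have "monom (add_mset (i, l) C + D1) - monom (add_mset (i, l) C + D1') \<in> J"
      by (rule Suc.hyps(1)) (use Suc.hyps(2) Suc.prems in \<open>simp_all add: D D'\<close>)
    then show ?thesis by (simp add: D D')
  next
    case False
    then have "(j, l) \<noteq> (i, k)" using ik by auto
    moreover obtain E where E: "D = add_mset (i, k) E" using ik by (metis insert_DiffM)
    ultimately have "(j, l) \<in># E" using jl by auto
    then obtain D1 where "E = add_mset (j, l) D1" by (metis insert_DiffM)
    then have D: "D = D1 + {#(i, k), (j, l)#}" using E by simp
    \<comment> \<open>The condition on classes depends only on the set of columns, and the swap
      exchanges rows while leaving the columns in place.\<close>
    have snd: "snd ` set_mset (C + D) = snd ` set_mset (add_mset (i, l) C + add_mset (j, k) D1)"
      by (auto simp: D)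
    have mixed: "(\<exists>v \<in># M. \<exists>w \<in># M. c (snd v) \<noteq> c (snd w)) \<longleftrightarrow>
      (\<exists>a \<in> snd ` set_mset M. \<exists>b \<in> snd ` set_mset M. c a \<noteq> c b)" for M :: "(nat \<times> nat) multiset"
      by auto
    have "monom (C + D1 + {#(i, k), (j, l)#}) - monom (C + D1 + {#(i, l), (j, k)#}) \<in> J"
    proof (rule swap_mem[OF J gen])
      have eq: "C + D1 + {#(i, k), (j, l)#} = C + D" by (simp add: D)
      show "\<exists>v \<in># C + D1 + {#(i, k), (j, l)#}. \<exists>w \<in># C + D1 + {#(i, k), (j, l)#}. c (snd v) \<noteq> c (snd w)"
        unfolding eq by (rule Suc.prems(4))
      show "set_mset (C + D1) \<subseteq> {1..m} \<times> {1..n}" "i \<in> {1..m}" "j \<in> {1..m}" "k \<in> {1..n}" "l \<in> {1..n}"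
        using Suc.prems(1) by (simp_all add: D D')
    qed
    moreover have "monom (add_mset (i, l) C + add_mset (j, k) D1) - monom (add_mset (i, l) C + D1') \<in> J"
    proof (rule Suc.hyps(1))
      show "d = size (add_mset (j, k) D1)" using Suc.hyps(2) by (simp add: D)
      show "set_mset (add_mset (i, l) C + add_mset (j, k) D1 + D1') \<subseteq> {1..m} \<times> {1..n}"
        using Suc.prems(1) by (auto simp: D D')
      show "image_mset fst (add_mset (j, k) D1) = image_mset fst D1'"
        "image_mset snd (add_mset (j, k) D1) = image_mset snd D1'"
        using Suc.prems(2,3) by (simp_all add: D D' add_mset_commute)
      show "\<exists>v \<in># add_mset (i, l) C + add_mset (j, k) D1. \<exists>w \<in># add_mset (i, l) C + add_mset (j, k) D1.
          c (snd v) \<noteq> c (snd w)"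
        using Suc.prems(4) unfolding mixed snd .
    qed
    ultimately have "(monom (C + D1 + {#(i, k), (j, l)#}) - monom (C + D1 + {#(i, l), (j, k)#})) +
      (monom (add_mset (i, l) C + add_mset (j, k) D1) - monom (add_mset (i, l) C + D1')) \<in> J"
      by (rule ideal_mpoly_ringD(3)[OF J])
    then show ?thesis by (simp add: D D' add_mset_commute[of "(j, k)"])
  qed
qed

lemma single_column_margins:
  assumes "\<And>v. v \<in># M \<Longrightarrow> snd v = q" "image_mset fst M = image_mset fst M'"
    "image_mset snd M = image_mset snd M'"
  shows "M = M'"
proof -
  have "snd v = q" if "v \<in># M'" for v
  proof -
    have "snd v \<in># image_mset snd M" using that assms(3) by simp
    then show ?thesis using assms(1) by auto
  qed
  then have "M' = image_mset (\<lambda>i. (i, q)) (image_mset fst M')"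
    by (simp add: image_mset.compositionality comp_def)
      (metis (mono_tags, lifting) image_mset_cong multiset.map_ident prod.collapse)
  moreover have "M = image_mset (\<lambda>i. (i, q)) (image_mset fst M)"
    using assms(1) by (simp add: image_mset.compositionality comp_def)
      (metis (mono_tags, lifting) image_mset_cong multiset.map_ident prod.collapse)
  ultimately show ?thesis using assms(2) by simp
qed

text \<open>The Segre parametrization \<open>x\<^sub>i\<^sub>j \<mapsto> s\<^sub>i t\<^sub>j\<close>, dehomogenized by \<open>s\<^sub>1 = 1\<close>. The variables
  \<open>s\<^sub>2, \<dots>, s\<^sub>m, t\<^sub>1, \<dots>, t\<^sub>n\<close> are numbered consecutively from \<open>0\<close> to \<open>m + n - 2\<close>.\<close>

definition segre_mon :: "nat \<Rightarrow> nat \<times> nat \<Rightarrow> nat multiset" where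
  "segre_mon m v = (if fst v = 1 then {#} else {#fst v - 2#}) + {#m - 2 + snd v#}"

definition segre :: "nat \<Rightarrow> nat \<times> nat \<Rightarrow> (nat, 'k::comm_ring_1) mpoly" where
  "segre m v = monom (segre_mon m v)"

lemma expo_eval_segre: "expo_eval (segre m) (expo M) = monom (\<Sum>v\<in>#M. segre_mon m v)"
  unfolding expo_eval_expo by (induction M) (simp_all add: segre_def monom_union)

text \<open>The numbers \<open>i - 2\<close> with \<open>2 \<le> i \<le> m\<close> stay below the
  numbers \<open>m - 2 + q\<close> with \<open>q \<ge> 1\<close>, so row and column counts do not
  mix. Setting \<open>s_1 = 1\<close> hides the count of row 1; it is recovered from the total
  number of entries, which the columns determine.\<close>

lemma segre_mon_margins:
  assumes m: "m \<ge> 2" and M: "set_mset M \<subseteq> {1..m} \<times> {1..n}" "set_mset M' \<subseteq> {1..m} \<times> {1..n}"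
    and eq: "(\<Sum>v\<in>#M. segre_mon m v) = (\<Sum>v\<in>#M'. segre_mon m v)"
  shows "image_mset fst M = image_mset fst M'" "image_mset snd M = image_mset snd M'"
proof -
  have col: "count (image_mset snd M) q = count (\<Sum>v\<in>#M. segre_mon m v) (m - 2 + q)"
    if "set_mset M \<subseteq> {1..m} \<times> {1..n}" "q \<ge> 1" for M q
    using that
  proof (induction M)
    case (add v M)
    then have "fst v - 2 \<noteq> m - 2 + q" using m by auto
    with add show ?case by (auto simp: segre_mon_def)
  qed simp
  have row: "count (image_mset fst M) i = count (\<Sum>v\<in>#M. segre_mon m v) (i - 2)"
    if "set_mset M \<subseteq> {1..m} \<times> {1..n}" "2 \<le> i" "i \<le> m" for M i
    using that
  proof (induction M)
    case (add v M)
    then have "m - 2 + snd v \<noteq> i - 2" "fst v - 2 = i - 2 \<and> fst v \<noteq> 1 \<longleftrightarrow> fst v = i" by auto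
    with add show ?case by (auto simp: segre_mon_def)
  qed simp
  have zero: "count (image_mset fst M) i = 0" if "set_mset M \<subseteq> {1..m} \<times> {1..n}" "i \<notin> {1..m}" for M i
    using that by (auto simp: not_in_iff[symmetric])
  have zero': "count (image_mset snd M) 0 = 0" if "set_mset M \<subseteq> {1..m} \<times> {1..n}" for M
    using that by (auto simp: not_in_iff[symmetric])
  show snd: "image_mset snd M = image_mset snd M'"
  proof (rule multiset_eqI)
    show "count (image_mset snd M) q = count (image_mset snd M') q" for q
      using col[OF M(1), of q] col[OF M(2), of q] zero'[OF M(1)] zero'[OF M(2)] eq
      by (cases "q = 0") auto
  qed
  have ne1: "count (image_mset fst M) i = count (image_mset fst M') i" if "i \<noteq> 1" for i
    using row[OF M(1), of i] row[OF M(2), of i] zero[OF M(1), of i] zero[OF M(2), of i] eq that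
    by (cases "i \<in> {1..m}") auto
  have size: "size (image_mset fst M) = size (image_mset fst M')"
    using arg_cong[OF snd, of size] by simp
  have split: "A = filter_mset (\<lambda>i. i \<noteq> 1) A + replicate_mset (count A 1) 1" for A :: "nat multiset"
    by (rule multiset_eqI) simp
  have "filter_mset (\<lambda>i. i \<noteq> 1) (image_mset fst M) = filter_mset (\<lambda>i. i \<noteq> 1) (image_mset fst M')"
    by (rule multiset_eqI) (use ne1 in auto)
  then show "image_mset fst M = image_mset fst M'"
    using split[of "image_mset fst M"] split[of "image_mset fst M'"] size
    by (metis add_left_imp_eq size_replicate_mset size_union)
qed

text \<open>The Segre map sends monomials to monomials, so in a kernel element the coefficients over
  each fiber sum to zero. Subtracting from each term the same multiple of a representative of its
  fiber thus leaves \<open>p\<close> unchanged and writes it as a combination of binomials with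
  equal margins.\<close>

lemma segre_kernel_mem:
  fixes J :: "(nat \<times> nat, 'k::field) mpoly set" and c :: "nat \<Rightarrow> 'c"
  assumes m: "m \<ge> 2" and J: "ideal J (matrix_ring m n)"
    and gen: "\<And>i j k l. i \<in> {1..m} \<Longrightarrow> j \<in> {1..m} \<Longrightarrow> k \<in> {1..n} \<Longrightarrow> l \<in> {1..n} \<Longrightarrow> c k \<noteq> c l \<Longrightarrow>
      mpoly_var (i, k) * mpoly_var (j, l) - mpoly_var (i, l) * mpoly_var (j, k) \<in> J"
    and p: "p \<in> carrier (matrix_ring m n)" "mpoly_eval (segre m) p = 0"
    and columns: "\<And>M. expo M \<in> Poly_Mapping.keys p \<Longrightarrow>
      (\<exists>v \<in># M. \<exists>w \<in># M. c (snd v) \<noteq> c (snd w)) \<or> (\<exists>q. \<forall>v \<in># M. snd v = q)"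
  shows "p \<in> J"
proof -
  note D = ideal_mpoly_ringD[OF J]
  let ?K = "Poly_Mapping.keys p" and ?c = "Poly_Mapping.lookup p"
  obtain Mf :: "(nat \<times> nat \<Rightarrow>\<^sub>0 nat) \<Rightarrow> (nat \<times> nat) multiset" where Mf: "\<And>t. t = expo (Mf t)"
    using expo_cases by metis
  define T where "T t = expo (\<Sum>v\<in>#Mf t. segre_mon m v)" for t
  \<comment> \<open>The representative is chosen in the support of \<open>p\<close>, which keeps its
    variables inside the matrix ring.\<close>
  define rep where "rep w = (SOME s. s \<in> ?K \<and> T s = w)" for w
  have rep: "rep (T t) \<in> ?K \<and> T (rep (T t)) = T t" if "t \<in> ?K" for t
    unfolding rep_def by (rule someI[of _ t]) (use that in simp)
  have eval: "expo_eval (segre m) t = Poly_Mapping.single (T t) (1::'k)" for t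
    using expo_eval_segre[of m "Mf t"] Mf[of t] by (simp add: T_def)
  have fiber: "(\<Sum>t\<in>{t \<in> ?K. T t = w}. ?c t) = 0" for w
  proof -
    have "0 = Poly_Mapping.lookup (mpoly_eval (segre m) p) w" using p(2) by simp
    also have "\<dots> = (\<Sum>t\<in>?K. if T t = w then ?c t else 0)"
      unfolding mpoly_eval_def lookup_sum eval
      by (rule sum.cong) (auto simp: mult_single lookup_single when_def)
    also have "\<dots> = (\<Sum>t\<in>{t \<in> ?K. T t = w}. ?c t)"
      by (rule sum.inter_filter[symmetric]) simp
    finally show ?thesis by simp
  qed
  have single_sum: "(\<Sum>t\<in>X. Poly_Mapping.single s (f t)) = Poly_Mapping.single s (\<Sum>t\<in>X. f t :: 'k)"
    for X s and f :: "(nat \<times> nat \<Rightarrow>\<^sub>0 nat) \<Rightarrow> 'k"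
    by (induction X rule: infinite_finite_induct) (simp_all add: single_add)
  have "(\<Sum>t\<in>?K. Poly_Mapping.single (rep (T t)) (?c t)) =
      (\<Sum>w\<in>T ` ?K. \<Sum>t\<in>{t \<in> ?K. T t = w}. Poly_Mapping.single (rep (T t)) (?c t))"
    by (rule sum.image_gen) simp
  also have "\<dots> = (\<Sum>w\<in>T ` ?K. \<Sum>t\<in>{t \<in> ?K. T t = w}. Poly_Mapping.single (rep w) (?c t))"
    by (intro sum.cong) auto
  also have "\<dots> = 0" by (simp add: single_sum fiber)
  finally have "p = (\<Sum>t\<in>?K. Poly_Mapping.single t (?c t) - Poly_Mapping.single (rep (T t)) (?c t))"
    using mpoly_eq_sum_single[of p] by (simp add: sum_subtractf)
  also have "\<dots> \<in> J"
  proof (rule D(8))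
    fix t assume t: "t \<in> ?K"
    define M M' where "M = Mf t" and "M' = Mf (rep (T t))"
    have e: "t = expo M" "rep (T t) = expo M'" using Mf by (simp_all add: M_def M'_def)
    have MV: "set_mset M \<subseteq> {1..m} \<times> {1..n}" "set_mset M' \<subseteq> {1..m} \<times> {1..n}"
      using p(1) t rep[OF t] e unfolding mpoly_ring_simps by (metis keys_expo)+
    have "expo (\<Sum>v\<in>#M. segre_mon m v) = expo (\<Sum>v\<in>#M'. segre_mon m v)"
      using rep[OF t] by (simp add: T_def M_def M'_def)
    then have "(\<Sum>v\<in>#M. segre_mon m v) = (\<Sum>v\<in>#M'. segre_mon m v)"
      by (metis lookup_expo multiset_eqI)
    note marg = segre_mon_margins[OF m MV this]
    have "monom M - monom M' \<in> J"
    proof (cases "\<exists>v \<in># M. \<exists>w \<in># M. c (snd v) \<noteq> c (snd w)")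
      case True
      then have "monom ({#} + M) - monom ({#} + M') \<in> J"
        by (intro equal_margins_mem[OF J gen]) (use MV marg in auto)
      then show ?thesis by simp
    next
      case False
      then obtain q where "\<forall>v \<in># M. snd v = q" using columns[of M] t e by blast
      then have "M = M'" using single_column_margins[OF _ marg, of q] by simp
      then show ?thesis using D(2) by simp
    qed
    then have "mpoly_const (?c t) * (monom M - monom M') \<in> J"
      using D(5) mpoly_const_in_carrier by blast
    then show "Poly_Mapping.single t (?c t) - Poly_Mapping.single (rep (T t)) (?c t) \<in> J"
      using e by (simp add: right_diff_distrib mult_single)
  qed
  finally show ?thesis .
qed

section \<open>The ideals of the decomposition\<close>

lemma part_unique:
  assumes "v \<in> part ns i" "v \<in> part ns j"
  shows "i = j"
proof -
  have False if "v \<in> part ns i" "v \<in> part ns j" "i < j" for i j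
  proof -
    have "(\<Sum>k\<in>{1..i}. ns k) \<le> (\<Sum>k\<in>{1..<j}. ns k)"
      using that(3) by (intro sum_mono2) auto
    then show False using that by (auto simp: part_def)
  qed
  then show ?thesis using assms by (metis linorder_neqE_nat)
qed

lemma part_Union: "(\<Union>k\<in>{1..r}. part ns k) = {1..(\<Sum>k\<in>{1..r}. ns k)}"
proof (induction r)
  case (Suc r)
  have "{1..Suc r} = insert (Suc r) {1..r}" by auto
  moreover have "{1..<Suc r} = {1..r}" by auto
  ultimately have "(\<Union>k\<in>{1..Suc r}. part ns k) =
      {1..(\<Sum>k\<in>{1..r}. ns k)} \<union> {1 + (\<Sum>k\<in>{1..r}. ns k)..(\<Sum>k\<in>{1..Suc r}. ns k)}"
    using Suc by (auto simp: part_def)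
  also have "\<dots> = {1..(\<Sum>k\<in>{1..Suc r}. ns k)}" by (auto simp: sum.cl_ivl_Suc)
  finally show ?case .
qed simp

lemma card_part: "k \<ge> 1 \<Longrightarrow> card (part ns k) = ns k"
proof -
  assume "k \<ge> 1"
  then have "{1..k} = insert k {1..<k}" by auto
  then show ?thesis by (simp add: part_def)
qed

lemma finite_part [simp]: "finite (part ns k)"
  by (simp add: part_def)

lemma multipartite_edgesI:
  "u \<in> part ns i \<Longrightarrow> v \<in> part ns j \<Longrightarrow> i \<in> {1..r} \<Longrightarrow> j \<in> {1..r} \<Longrightarrow> i \<noteq> j \<Longrightarrow>
    {u, v} \<in> multipartite_edges r ns"
  unfolding multipartite_edges_def by blast

lemma minor_closed:
  assumes "i \<in> {1..m}" "j \<in> {1..m}" "k \<in> {1..n}" "l \<in> {1..n}"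
  shows "mpoly_var (i, k) * mpoly_var (j, l) - mpoly_var (i, l) * mpoly_var (j, k) \<in>
    carrier (matrix_ring m n)"
proof -
  have "mpoly_var (i, k) \<in> carrier (matrix_ring m n)" if "i \<in> {1..m}" "k \<in> {1..n}" for i k
    using that by (intro mpoly_var_in_carrier) simp
  then show ?thesis
    unfolding diff_conv_add_uminus using assms by (intro mpoly_ring_closed)
qed

lemma gen_binomial_edge_ideal_ideal:
  "ideal (gen_binomial_edge_ideal m n E :: (nat \<times> nat, 'k::field) mpoly set) (matrix_ring m n)"
  and gen_binomial_edge_ideal_gen:
  "\<And>i j k l. i \<in> {1..m} \<Longrightarrow> j \<in> {1..m} \<Longrightarrow> k \<in> {1..n} \<Longrightarrow> l \<in> {1..n} \<Longrightarrow> k \<noteq> l \<Longrightarrow> {k, l} \<in> E \<Longrightarrow>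
    mpoly_var (i, k) * mpoly_var (j, l) - mpoly_var (i, l) * mpoly_var (j, k) \<in>
      (gen_binomial_edge_ideal m n E :: (nat \<times> nat, 'k) mpoly set)"
  and gen_binomial_edge_ideal_subset:
  "\<And>I. ideal I (matrix_ring m n) \<Longrightarrow>
    (\<And>i j k l. i \<in> {1..m} \<Longrightarrow> j \<in> {1..m} \<Longrightarrow> k \<in> {1..n} \<Longrightarrow> l \<in> {1..n} \<Longrightarrow> k \<noteq> l \<Longrightarrow> {k, l} \<in> E \<Longrightarrow>
      mpoly_var (i, k) * mpoly_var (j, l) - mpoly_var (i, l) * mpoly_var (j, k) \<in> I) \<Longrightarrow>
    (gen_binomial_edge_ideal m n E :: (nat \<times> nat, 'k) mpoly set) \<subseteq> I"
proof -
  interpret S: cring "matrix_ring m n :: (nat \<times> nat, 'k) mpoly ring" by (rule cring_mpoly_ring)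
  let ?x = "\<lambda>i k. mpoly_var (i, k) :: (nat \<times> nat, 'k) mpoly"
  define X where "X = {?x i k * ?x j l - ?x i l * ?x j k | i j k l.
    1 \<le> i \<and> i < j \<and> j \<le> m \<and> k \<in> {1..n} \<and> l \<in> {1..n} \<and> k < l \<and> {k, l} \<in> E}"
  have eq: "gen_binomial_edge_ideal m n E = genideal (matrix_ring m n) X"
    by (simp add: gen_binomial_edge_ideal_def X_def)
  have X: "X \<subseteq> carrier (matrix_ring m n)"
    unfolding X_def by clarify (rule minor_closed; simp)
  show id: "ideal (gen_binomial_edge_ideal m n E :: (nat \<times> nat, 'k) mpoly set) (matrix_ring m n)"
    unfolding eq by (rule S.genideal_ideal[OF X])
  note D = ideal_mpoly_ringD[OF id]
  have mem: "?x i k * ?x j l - ?x i l * ?x j k \<in> gen_binomial_edge_ideal m n E"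
    if "1 \<le> i" "i < j" "j \<le> m" "k \<in> {1..n}" "l \<in> {1..n}" "k < l" "{k, l} \<in> E" for i j k l
  proof -
    have "?x i k * ?x j l - ?x i l * ?x j k \<in> X" unfolding X_def using that by blast
    then show ?thesis unfolding eq using S.genideal_self[OF X] by blast
  qed
  have mem': "?x i k * ?x j l - ?x i l * ?x j k \<in> gen_binomial_edge_ideal m n E"
    if "1 \<le> i" "i < j" "j \<le> m" "k \<in> {1..n}" "l \<in> {1..n}" "k \<noteq> l" "{k, l} \<in> E" for i j k l
  proof (cases "k < l")
    case False
    then have "?x i l * ?x j k - ?x i k * ?x j l \<in> gen_binomial_edge_ideal m n E"
      using that by (intro mem) (auto simp: insert_commute)
    then show ?thesis using D(6) by fastforce
  qed (use mem that in blast)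
  show "?x i k * ?x j l - ?x i l * ?x j k \<in> gen_binomial_edge_ideal m n E"
    if ij: "i \<in> {1..m}" "j \<in> {1..m}" "k \<in> {1..n}" "l \<in> {1..n}" "k \<noteq> l" "{k, l} \<in> E" for i j k l
  proof (cases i j rule: linorder_cases)
    case less
    then show ?thesis using mem' ij by auto
  next
    case equal
    then show ?thesis using D(2) by (simp add: mult.commute)
  next
    case greater
    then have "?x j k * ?x i l - ?x j l * ?x i k \<in> gen_binomial_edge_ideal m n E"
      using ij by (intro mem') auto
    then have "- (?x j k * ?x i l - ?x j l * ?x i k) \<in> gen_binomial_edge_ideal m n E" by (rule D(6))
    then show ?thesis by (simp add: mult.commute)
  qed
  show "gen_binomial_edge_ideal m n E \<subseteq> I"
    if I: "ideal I (matrix_ring m n)"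
      and gens: "\<And>i j k l. i \<in> {1..m} \<Longrightarrow> j \<in> {1..m} \<Longrightarrow> k \<in> {1..n} \<Longrightarrow> l \<in> {1..n} \<Longrightarrow> k \<noteq> l \<Longrightarrow>
        {k, l} \<in> E \<Longrightarrow> ?x i k * ?x j l - ?x i l * ?x j k \<in> I" for I
    unfolding eq by (rule S.genideal_minimal[OF I]) (auto simp: X_def intro!: gens)
qed

lemma complete_edges_iff:
  "k \<in> {1..n} \<Longrightarrow> l \<in> {1..n} \<Longrightarrow> {k, l} \<in> complete_edges n \<longleftrightarrow> k \<noteq> l"
  by (auto simp: complete_edges_def doubleton_eq_iff)

lemma gen_binomial_edge_ideal_complete:
  assumes m: "m \<ge> 2"
  shows "gen_binomial_edge_ideal m n (complete_edges n) =
    (subst_ideal ({1..m} \<times> {1..n}) (segre m) {} :: (nat \<times> nat, 'k::field) mpoly set)"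
proof
  let ?P = "subst_ideal ({1..m} \<times> {1..n}) (segre m) {} :: (nat \<times> nat, 'k) mpoly set"
  have prime: "primeideal ?P (matrix_ring m n)" by (rule primeideal_subst_ideal)
  show "gen_binomial_edge_ideal m n (complete_edges n) \<subseteq> ?P"
  proof (rule gen_binomial_edge_ideal_subset[OF primeideal.axioms(1)[OF prime]])
    fix i j k l assume ij: "i \<in> {1..m}" "j \<in> {1..m}" "k \<in> {1..n}" "l \<in> {1..n}"
    note minor_closed[OF this]
    moreover have "segre m (i, k) * segre m (j, l) = segre m (i, l) * (segre m (j, k) :: (nat, 'k) mpoly)"
      by (simp add: segre_def segre_mon_def add_mset_commute flip: monom_union)
    ultimately show "mpoly_var (i, k) * mpoly_var (j, l) - mpoly_var (i, l) * mpoly_var (j, k) \<in> ?P"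
      by (simp add: subst_ideal_empty mpoly_eval_diff mpoly_eval_mult)
  qed
  show "?P \<subseteq> gen_binomial_edge_ideal m n (complete_edges n)"
  proof
    fix p assume p: "p \<in> ?P"
    show "p \<in> gen_binomial_edge_ideal m n (complete_edges n)"
    \<comment> \<open>With \<open>c = id\<close> every column is its own class, so a monomial within
      one class lies in a single column.\<close>
    proof (rule segre_kernel_mem[OF m gen_binomial_edge_ideal_ideal, where c = id])
      show "p \<in> carrier (matrix_ring m n)" "mpoly_eval (segre m) p = 0"
        using p by (simp_all add: subst_ideal_empty)
      show "(\<exists>v \<in># M. \<exists>w \<in># M. id (snd v) \<noteq> id (snd w)) \<or> (\<exists>q. \<forall>v \<in># M. snd v = q)" for M
        by (cases "M = {#}") (auto, metis)
    qed (auto intro!: gen_binomial_edge_ideal_gen simp: complete_edges_iff)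
  qed
qed

lemma column_ideal_eq:
  assumes "T \<subseteq> {1..n}"
  shows "column_ideal m n T =
    (subst_ideal ({1..m} \<times> {1..n}) mpoly_var ({1..m} \<times> T) :: (nat \<times> nat, 'k::field) mpoly set)"
proof -
  have "{mpoly_var (i, j) | i j. i \<in> {1..m} \<and> j \<in> T} =
      (mpoly_var ` ({1..m} \<times> T) :: (nat \<times> nat, 'k) mpoly set)" by blast
  then show ?thesis
    unfolding column_ideal_def using assms by (simp only:) (rule genideal_variables, blast)
qed

theorem proposition3p5:
  fixes m r s n :: nat and ns :: "nat \<Rightarrow> nat"
    and S :: "(nat \<times> nat, 'k::field) mpoly ring"
    and J Jc :: "(nat \<times> nat, 'k) mpoly set"
    and A :: "nat \<Rightarrow> (nat \<times> nat, 'k) mpoly set"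
  assumes "m \<ge> 2" and "r \<ge> 2"
    and "\<forall>k \<in> {1..r}. ns k > 0"
    and "ns r \<ge> 2"
    and "s \<in> {1..r}"
    and "\<forall>k \<in> {1..<s}. ns k = 1"
    and "1 < ns s"
    and "\<forall>k \<in> {s..<r}. ns k \<le> ns (Suc k)"
    and "n = (\<Sum>k \<in> {1..r}. ns k)"
    and "S = matrix_ring m n"
    and "J = gen_binomial_edge_ideal m n (multipartite_edges r ns)"
    and "Jc = gen_binomial_edge_ideal m n (complete_edges n)"
    and "\<forall>k \<in> {s..r}. A k = column_ideal m n (\<Union>j \<in> {1..r} - {k}. part ns j)"
  shows "J = Jc \<inter> (\<Inter>k \<in> {s..r}. A k) \<and>
    minimal_primary_decomposition S J (Jc # map A [s..<Suc r]) \<and>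
    (\<forall>Qs. minimal_primary_decomposition S J Qs \<longrightarrow> mset Qs = mset (Jc # map A [s..<Suc r])) \<and>
    krull_dim (S Quot J) = enat (max (m + n - 1) (m * ns r))"
proof -
  define V where "V = {1..m} \<times> {1..n}"
  define T where "T k = (\<Union>j \<in> {1..r} - {k}. part ns j)" for k
  define U where "U k = {1..m} \<times> T k" for k
  have n: "{1..n} = (\<Union>k\<in>{1..r}. part ns k)" unfolding part_Union using assms(9) by simp
  have T: "T k \<subseteq> {1..n}" for k unfolding n T_def by blast
  have S: "S = mpoly_ring V" using assms(10) by (simp add: V_def)
  interpret S: cring S unfolding S by (rule cring_mpoly_ring)
  have Jc: "Jc = subst_ideal V (segre m) {}"
    using assms(1,12) by (simp add: gen_binomial_edge_ideal_complete V_def)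
  have A: "A k = subst_ideal V mpoly_var (U k)" if "k \<in> {s..r}" for k
    using assms(13) that column_ideal_eq[OF T] by (simp add: V_def U_def T_def)
  have T_iff: "v \<in> T k \<longleftrightarrow> v \<notin> part ns k" if "v \<in> {1..n}" for v k
    using that part_unique[of v ns] unfolding n T_def by blast
  have idJ: "ideal J S" unfolding S V_def assms(11) by (rule gen_binomial_edge_ideal_ideal)
  have primeJc: "primeideal Jc S" unfolding S Jc by (rule primeideal_subst_ideal)
  have primeA: "primeideal (A k) S" if "k \<in> {s..r}" for k
    unfolding S A[OF that] by (rule primeideal_subst_ideal)
  have x: "(mpoly_var (i, k) :: (nat \<times> nat, 'k) mpoly) \<in> carrier (mpoly_ring V)" if "i \<in> {1..m}" "k \<in> {1..n}" for i k
    using that by (intro mpoly_var_in_carrier) (simp add: V_def)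
  have xA: "mpoly_var (i, v) \<in> A k \<longleftrightarrow> v \<notin> part ns k"
    if "k \<in> {s..r}" "i \<in> {1..m}" "v \<in> {1..n}" for i v k
    using x[OF that(2,3)] that T_iff[OF that(3)]
    by (simp add: A subst_ideal_def U_def) (simp add: mpoly_var_def)

  \<comment> \<open>The intersection formula\<close>
  have "J \<subseteq> Jc"
    unfolding assms(11)
  proof (rule gen_binomial_edge_ideal_subset)
    show "ideal Jc (matrix_ring m n)" unfolding assms(12) by (rule gen_binomial_edge_ideal_ideal)
  qed (auto simp: assms(12) complete_edges_iff intro!: gen_binomial_edge_ideal_gen)
  moreover have "J \<subseteq> A k" if k: "k \<in> {s..r}" for k
    unfolding assms(11)
  proof (rule gen_binomial_edge_ideal_subset)
    have id: "ideal (A k) (mpoly_ring V)" using primeA[OF k] S by (simp add: primeideal.axioms(1))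
    then show "ideal (A k) (matrix_ring m n)" by (simp add: V_def)
    note D = ideal_mpoly_ringD[OF id]
    fix i j u v assume ij: "i \<in> {1..m}" "j \<in> {1..m}" "u \<in> {1..n}" "v \<in> {1..n}"
      and "{u, v} \<in> multipartite_edges r ns"
    then obtain a b i' j' where e: "{u, v} = {a, b}" "i' \<noteq> j'" "a \<in> part ns i'" "b \<in> part ns j'"
      unfolding multipartite_edges_def by blast
    have "\<not> {a, b} \<subseteq> part ns k" using part_unique[of a ns i' k] part_unique[of b ns j' k] e by auto
    \<comment> \<open>Each term of the minor has a variable in column \<open>u\<close> and one in
      column \<open>v\<close>, so one such column outside part \<open>k\<close> puts both terms into
      \<open>A k\<close>.\<close>
    then have "u \<notin> part ns k \<or> v \<notin> part ns k" unfolding e(1)[symmetric] by simp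
    then show "mpoly_var (i, u) * mpoly_var (j, v) - mpoly_var (i, v) * mpoly_var (j, u) \<in> A k"
      using xA[OF k] ij x D(4,5,7) by metis
  qed
  moreover have "p \<in> J" if pJc: "p \<in> Jc" and pA: "\<And>k. k \<in> {s..r} \<Longrightarrow> p \<in> A k" for p
  proof -
    define c where "c v = (SOME k. k \<in> {1..r} \<and> v \<in> part ns k)" for v
    have c: "c v \<in> {1..r} \<and> v \<in> part ns (c v)" if "v \<in> {1..n}" for v
      unfolding c_def by (rule someI_ex) (use that n in blast)
    show ?thesis
    proof (rule segre_kernel_mem[OF assms(1) idJ[unfolded assms(10)], where c = c])
      fix i j k l assume ij: "i \<in> {1..m}" "j \<in> {1..m}" "k \<in> {1..n}" "l \<in> {1..n}" "c k \<noteq> c l"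
      then show "mpoly_var (i, k) * mpoly_var (j, l) - mpoly_var (i, l) * mpoly_var (j, k) \<in> J"
        unfolding assms(11) using multipartite_edgesI[of k ns "c k" l "c l" r] c
        by (intro gen_binomial_edge_ideal_gen) auto
    next
      show p: "p \<in> carrier (matrix_ring m n)" "mpoly_eval (segre m) p = 0"
        using pJc by (simp_all add: Jc subst_ideal_empty V_def)
      fix M assume M: "expo M \<in> Poly_Mapping.keys p"
      then have MV: "set_mset M \<subseteq> V" using p(1) unfolding mpoly_ring_simps V_def by (metis keys_expo)
      show "(\<exists>v \<in># M. \<exists>w \<in># M. c (snd v) \<noteq> c (snd w)) \<or> (\<exists>q. \<forall>v \<in># M. snd v = q)"
      proof (cases "\<exists>v \<in># M. \<exists>w \<in># M. c (snd v) \<noteq> c (snd w)")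
        case False
        show ?thesis
        proof (cases "M = {#}")
          case ne: False
          then obtain w where w: "w \<in># M" by blast
          define k where "k = c (snd w)"
          have col: "snd v \<in> {1..n}" if "v \<in># M" for v using MV that by (auto simp: V_def)
          have k: "snd v \<in> part ns k" if "v \<in># M" for v
            using False c[OF col[OF that]] that w unfolding k_def by metis
          \<comment> \<open>Membership in \<open>A k\<close> would force \<open>M\<close> to use a
            column outside part \<open>k\<close>, but all its columns lie in that part. So
            \<open>k < s\<close>, and the part is a single column.\<close>
          have "\<not> s \<le> k"
          proof
            assume "s \<le> k"
            then have ks: "k \<in> {s..r}" using c[OF col[OF w]] by (simp add: k_def)
            have "Poly_Mapping.keys (expo M) \<inter> U k \<noteq> {}"
              using pA[OF ks] M unfolding A[OF ks] subst_ideal_def mpoly_eval_mpoly_var by blast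
            then obtain v where "v \<in># M" "v \<in> U k" unfolding keys_expo by blast
            then show False using T_iff[OF col, of v k] k[of v] by (auto simp: U_def)
          qed
          then have "card (part ns k) = 1" using assms(6) c[OF col[OF w]] by (simp add: card_part k_def)
          then obtain q where "part ns k = {q}" by (rule card_1_singletonE)
          then show ?thesis using k by blast
        qed simp
      qed simp
    qed
  qed
  ultimately have J: "J = Jc \<inter> (\<Inter>k \<in> {s..r}. A k)" by blast

  \<comment> \<open>Incomparability of the prime components\<close>
  have part_sub: "part ns k \<subseteq> {1..n}" if "k \<in> {1..r}" for k unfolding n using that by blast
  have part_ne: "part ns k \<noteq> {}" if "k \<in> {1..r}" for k
    using card_part[of k ns] that assms(3) by fastforce
  have A_Jc: "\<not> A k \<subseteq> Jc" if k: "k \<in> {s..r}" for k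
  proof -
    \<comment> \<open>As \<open>r \<ge> 2\<close>, some part differs from part \<open>k\<close>. A
      variable in its columns lies in \<open>A k\<close>, but the Segre map sends it to a monomial,
      which is nonzero.\<close>
    define j where "j = (if k = 1 then 2 else 1 :: nat)"
    have j: "j \<in> {1..r}" "j \<noteq> k" using assms(2) by (auto simp: j_def)
    obtain v where v: "v \<in> part ns j" using part_ne[OF j(1)] by blast
    then have "v \<in> {1..n}" "v \<notin> part ns k" using part_sub[OF j(1)] part_unique[of v ns j k] j by blast+
    then have "mpoly_var (1, v) \<in> A k" using xA[OF k] assms(1) by auto
    moreover have "Poly_Mapping.single t (1 :: 'k) \<noteq> 0" for t :: "nat \<Rightarrow>\<^sub>0 nat"
      by (metis lookup_single_eq lookup_zero zero_neq_one)
    then have "mpoly_var (1, v) \<notin> Jc" by (simp add: Jc subst_ideal_empty segre_def)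
    ultimately show ?thesis by blast
  qed
  have ns_mono: "ns k \<le> ns l" if "s \<le> k" "k \<le> l" "l \<le> r" for k l
    using that(2,3)
  proof (induction l rule: dec_induct)
    case (step l)
    then show ?case using assms(8) that(1) by (metis Suc_leD atLeastLessThan_iff le_trans Suc_le_eq)
  qed simp
  have Jc_A: "\<not> Jc \<subseteq> A k" if k: "k \<in> {s..r}" for k
  proof
    assume sub: "Jc \<subseteq> A k"
    have "card (part ns k) \<ge> 2"
      using ns_mono[of s k] assms(5,7) k by (simp add: card_part)
    then obtain u v where uv: "u \<in> part ns k" "v \<in> part ns k" "u \<noteq> v"
      by (metis card_2_iff' card_le_Suc0_iff_eq finite_part not_less_eq_eq numeral_2_eq_2)
    have k1: "k \<in> {1..r}" using k assms(5) by simp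
    have un: "u \<in> {1..n}" "v \<in> {1..n}" using uv part_sub[OF k1] by auto
    \<comment> \<open>A minor with both columns in part \<open>k\<close>: its two monomials are
      distinct, so neither cancels, and both avoid \<open>U k\<close>. The two columns exist because
      \<open>ns k \<ge> ns s > 1\<close>.\<close>
    let ?f = "mpoly_var (1, u) * mpoly_var (2, v) - mpoly_var (1, v) * mpoly_var (2, u) :: (nat \<times> nat, 'k) mpoly"
    have "?f \<in> Jc"
      unfolding assms(12) using un uv assms(1)
      by (intro gen_binomial_edge_ideal_gen) (auto simp: complete_edges_iff)
    then have "?f \<in> A k" using sub by blast
    moreover have "?f = monom {#(1, u), (2, v)#} - monom {#(1, v), (2, u)#}"
      by (simp add: monom_add_mset)
    moreover have "{#(1::nat, u), (2, v)#} \<noteq> {#(1, v), (2, u)#}"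
      using uv(3) by (auto simp: add_eq_conv_ex)
    then have "expo {#(1::nat, u), (2, v)#} \<noteq> expo {#(1, v), (2, u)#}"
      by (metis lookup_expo multiset_eqI)
    ultimately have "expo {#(1, u), (2, v)#} \<in> Poly_Mapping.keys ?f"
      by (simp add: in_keys_iff lookup_minus lookup_single when_def)
    then have "{(1, u), (2, v)} \<inter> U k \<noteq> {}"
      using \<open>?f \<in> A k\<close> unfolding A[OF k] subst_ideal_def by fastforce
    then show False using uv un T_iff by (auto simp: U_def)
  qed
  have A_A: "k = l" if kl: "k \<in> {s..r}" "l \<in> {s..r}" "A k \<subseteq> A l" for k l
  proof (rule ccontr)
    assume "k \<noteq> l"
    have l: "l \<in> {1..r}" using kl(2) assms(5) by simp
    obtain v where v: "v \<in> part ns l" using part_ne[OF l] by blast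
    then have vn: "v \<in> {1..n}" "v \<notin> part ns k"
      using part_sub[OF l] part_unique[of v ns l k] \<open>k \<noteq> l\<close> by blast+
    then have "mpoly_var (1, v) \<in> A k" using xA[OF kl(1)] assms(1) by auto
    moreover have "mpoly_var (1, v) \<notin> A l" using xA[OF kl(2), of 1 v] vn v assms(1) by simp
    ultimately show False using kl(3) by blast
  qed
  let ?Ps = "Jc # map A [s..<Suc r]"
  have set: "set ?Ps = insert Jc (A ` {s..r})" by (auto simp: atLeastLessThanSuc_atLeastAtMost)
  have prime: "primeideal P S" if "P \<in> set ?Ps" for P
    using that primeJc primeA unfolding set by blast
  have incomp: "P = Q" if "P \<in> set ?Ps" "Q \<in> set ?Ps" "P \<subseteq> Q" for P Q
    using that A_Jc Jc_A A_A unfolding set by blast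
  have "inj_on A {s..r}" using A_A by (intro inj_onI) auto
  moreover have "Jc \<notin> A ` {s..r}" using A_Jc by blast
  ultimately have dist: "distinct ?Ps"
    by (simp add: distinct_map atLeastLessThanSuc_atLeastAtMost del: upt_Suc)
  have inter: "J = carrier S \<inter> \<Inter> (set ?Ps)"
    unfolding set J using ideal_mpoly_ringD(1)[of Jc V] primeJc S
    by (auto dest: primeideal.axioms(1))

  \<comment> \<open>Upper bound for the dimension\<close>
  have le: "l \<le> max (m + n - 1) (m * ns r)"
    if P: "\<And>i. i \<le> l \<Longrightarrow> primeideal (P i) S \<and> J \<subseteq> P i" "\<And>i. i < l \<Longrightarrow> P i \<subset> P (Suc i)" for l P
  proof -
    have "\<exists>Q \<in> set ?Ps. Q \<subseteq> P 0"
      using P(1)[of 0] inter prime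
      by (intro S.finite_Inter_subset_primeideal) (auto simp: primeideal.axioms(1))
    then consider "Jc \<subseteq> P 0" | k where "k \<in> {s..r}" "A k \<subseteq> P 0" unfolding set by blast
    then show ?thesis
    proof cases
      case 1
      have "l \<le> card {..<m + n - 1}"
      proof (rule prime_chain_le_card)
        show "primeideal (P i) (mpoly_ring V)" if "i \<le> l" for i using P(1) that S by blast
        show "subst_ideal V (segre m) {} \<subseteq> P 0" using 1 Jc by simp
        show "segre m v \<in> carrier (mpoly_ring {..<m + n - 1})" if "v \<in> V" for v
          using that assms(1) by (auto simp: segre_def segre_mon_def V_def mpoly_ring_simps)
      qed (use P(2) in auto)
      then show ?thesis by simp
    next
      case (2 k)
      have k: "k \<in> {1..r}" using 2 assms(5) by simp
      have "l \<le> card ({1..m} \<times> part ns k)"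
      proof (rule prime_chain_le_card)
        show "primeideal (P i) (mpoly_ring V)" if "i \<le> l" for i using P(1) that S by blast
        show "subst_ideal V (kill (U k)) {} \<subseteq> P 0"
          using 2 A[OF 2(1)] by (simp add: subst_ideal_kill)
        show "kill (U k) v \<in> carrier (mpoly_ring ({1..m} \<times> part ns k))" if "v \<in> V" for v
          using that T_iff[of "snd v" k]
          by (auto simp: kill_def U_def V_def intro: mpoly_var_in_carrier mpoly_ring_closed)
      qed (use P(2) in auto)
      also have "\<dots> = m * ns k" using k by (simp add: card_cartesian_product card_part)
      also have "\<dots> \<le> m * ns r" using ns_mono[of k r] 2 by simp
      finally show ?thesis by simp
    qed
  qed

  \<comment> \<open>Chains attaining the dimension\<close>
  have "\<exists>P. (\<forall>i \<le> m + n - 1. primeideal (P i) S \<and> J \<subseteq> P i) \<and> (\<forall>i < m + n - 1. P i \<subset> P (Suc i))"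
  proof (intro exI conjI allI impI)
    let ?P = "\<lambda>i. subst_ideal V (segre m) {..<i}"
    fix i :: nat
    show "primeideal (?P i) S" unfolding S by (rule primeideal_subst_ideal)
    have "Jc \<subseteq> ?P i" unfolding Jc by (rule subst_ideal_mono) simp
    then show "J \<subseteq> ?P i" using J by blast
  next
    let ?P = "\<lambda>i. subst_ideal V (segre m) {..<i}"
    fix i assume i: "i < m + n - 1"
    have "n \<ge> 1" using part_ne[of r] part_sub[of r] assms(2) by fastforce
    \<comment> \<open>The image of \<open>v\<close> contains the target variable numbered
      \<open>i\<close> and none with a smaller number: \<open>x_(i+2,1)\<close> maps to
      \<open>s_(i+2) t_1\<close>, where \<open>t_1\<close> has number \<open>m - 1 > i\<close>, and
      the first row maps to the \<open>t_j\<close> alone. The \<open>s_i\<close> have to be erased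
      first, since every image contains some \<open>t_j\<close>.\<close>
    define v where "v = (if i < m - 1 then (i + 2, 1) else (1, i - (m - 2)))"
    show "?P i \<subset> ?P (Suc i)"
    proof (rule subst_ideal_psubset)
      show "mpoly_var v \<in> carrier (mpoly_ring V)"
        using i \<open>n \<ge> 1\<close> assms(1) by (intro mpoly_var_in_carrier) (auto simp: v_def V_def)
      show "mpoly_eval (segre m) (mpoly_var v) = monom (segre_mon m v)" by (simp add: segre_def)
      show "set_mset (segre_mon m v) \<inter> {..<i} = {}" "set_mset (segre_mon m v) \<inter> {..<Suc i} \<noteq> {}"
        using i assms(1) by (auto simp: v_def segre_mon_def)
    qed auto
  qed
  moreover have "\<exists>P. (\<forall>i \<le> m * ns r. primeideal (P i) S \<and> J \<subseteq> P i) \<and> (\<forall>i < m * ns r. P i \<subset> P (Suc i))"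
  proof -
    have r: "r \<in> {s..r}" "r \<in> {1..r}" using assms(2,5) by auto
    let ?B = "{1..m} \<times> part ns r"
    have "card ?B = m * ns r" using r by (simp add: card_cartesian_product card_part)
    then obtain b where b: "bij_betw b {..<m * ns r} ?B"
      by (metis bij_betw_iff_card card_lessThan finite_SigmaI finite_atLeastAtMost finite_lessThan finite_part)
    \<comment> \<open>Starts at \<open>A r\<close> and erases the variables in the columns of part
      \<open>r\<close> in the order given by \<open>b\<close>.\<close>
    let ?P = "\<lambda>i. subst_ideal V mpoly_var (U r \<union> b ` {..<i})"
    show ?thesis
    proof (intro exI[of _ ?P] conjI allI impI)
      show "primeideal (?P i) S" for i unfolding S by (rule primeideal_subst_ideal)
      have "A r \<subseteq> ?P i" for i unfolding A[OF r(1)] by (rule subst_ideal_mono) simp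
      then show "J \<subseteq> ?P i" for i using J r by blast
    next
      fix i assume i: "i < m * ns r"
      have bi: "b i \<in> ?B" using b i by (auto simp: bij_betw_def)
      then have biV: "b i \<in> V" using part_sub[OF r(2)] by (auto simp: V_def)
      show "?P i \<subset> ?P (Suc i)"
      proof (rule subst_ideal_psubset)
        show "mpoly_var (b i) \<in> carrier (mpoly_ring V)" using biV by (rule mpoly_var_in_carrier)
        show "mpoly_eval mpoly_var (mpoly_var (b i)) = monom {#b i#}"
          by (simp add: monom_add_mset)
        have "b i \<notin> U r" using bi T_iff[of "snd (b i)" r] part_sub[OF r(2)] by (auto simp: U_def)
        moreover have "b i \<notin> b ` {..<i}"
          using b i by (auto simp: bij_betw_def dest: inj_onD)
        ultimately show "set_mset {#b i#} \<inter> (U r \<union> b ` {..<i}) = {}" by simp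
      qed auto
    qed
  qed
  ultimately have ex: "\<exists>P. (\<forall>i \<le> max (m + n - 1) (m * ns r). primeideal (P i) S \<and> J \<subseteq> P i) \<and>
      (\<forall>i < max (m + n - 1) (m * ns r). P i \<subset> P (Suc i))"
    by (simp add: max_def)
  have "krull_dim (S Quot J) = enat (max (m + n - 1) (m * ns r))"
    unfolding S.krull_dim_quot[OF idJ]
  proof (rule antisym)
    show "Sup {enat l | l. \<exists>P :: nat \<Rightarrow> (nat \<times> nat, 'k) mpoly set.
        (\<forall>i \<le> l. primeideal (P i) S \<and> J \<subseteq> P i) \<and> (\<forall>i < l. P i \<subset> P (Suc i))}
      \<le> enat (max (m + n - 1) (m * ns r))"
    proof (rule Sup_least, clarify)
      fix l and P :: "nat \<Rightarrow> (nat \<times> nat, 'k) mpoly set"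
      assume "\<forall>i \<le> l. primeideal (P i) S \<and> J \<subseteq> P i" "\<forall>i < l. P i \<subset> P (Suc i)"
      then show "enat l \<le> enat (max (m + n - 1) (m * ns r))"
        using le[of l P] by (simp only: enat_ord_simps)
    qed
    show "enat (max (m + n - 1) (m * ns r)) \<le> Sup {enat l | l. \<exists>P :: nat \<Rightarrow> (nat \<times> nat, 'k) mpoly set.
        (\<forall>i \<le> l. primeideal (P i) S \<and> J \<subseteq> P i) \<and> (\<forall>i < l. P i \<subset> P (Suc i))}"
      using ex by (intro Sup_upper) blast
  qed
  then show ?thesis
    using J S.minimal_primary_decomposition_primes[of ?Ps J, OF prime incomp dist inter]
      S.minimal_primary_decomposition_primes_unique[of ?Ps J, OF prime incomp dist inter] by blast
qed

end
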